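(* Let $J \geq 1$ and $d\ge 1$, and for every $n \geq 1$ let $\mu_1^n,\dots,\mu_J^n \in \mathcal{P}_2(\mathbb{R}^d)$ be probability measures such that, for each $1\le j\le J$, $W_2(\mu_j^n,\mu_j)\to 0$ as $n\to\infty$ for some $\mu_j\in\mathcal{P}_2(\mathbb{R}^d)$. Let $\lambda_1,\dots,\lambda_J>0$ with $\sum_{j=1}^J\lambda_j=1$. For every $n\ge 1$ let $\mu_B^n$ be a barycenter of $(\mu_j^n,\lambda_j)_{1\le j\le J}$. Then the sequence $(\mu_B^n)_{n\ge 1}$ is relatively compact in $(\mathcal{P}_2(\mathbb{R}^d),W_2)$, and each of its limit points (in $W_2$) is a barycenter of $(\mu_j,\lambda_j)_{1\le j\le J}$.
   Context: $\mathcal{P}_2(\mathbb{R}^d)$ is the set of Borel probability measures on $\mathbb{R}^d$ with finite second-order moment. $W_2$ is the 2-Wasserstein distance: $W_2^2(\mu,\nu)=\inf_\pi \int |x-y|^2\,d\pi(x,y)$, the infimum being over all probability measures $\pi$ on $\mathbb{R}^d\times\mathbb{R}^d$ with first marginal $\mu$ and second marginal $\nu$. Given $\nu_1,\dots,\nu_J\in\mathcal{P}_2(\mathbb{R}^d)$ and weights $\lambda_j\ge 0$ with $\sum_j\lambda_j=1$, a barycenter of $(\nu_j,\lambda_j)_{1\le j\le J}$ is a measure $\mu\in\mathcal{P}_2(\mathbb{R}^d)$ minimizing $\nu\mapsto\sum_{j=1}^J\lambda_jW_2^2(\nu,\nu_j)$ over $\mathcal{P}_2(\mathbb{R}^d)$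 (it need not be unique). *)

theory Defs
  imports "HOL-Probability.Probability"
begin

definition P2 :: "'a::euclidean_space measure set" where
  "P2 = {\<mu>. prob_space \<mu> \<and> sets \<mu> = sets borel \<and> (\<integral>\<^sup>+ x. ennreal ((norm x)\<^sup>2) \<partial>\<mu>) < \<infinity>}"

definition couplings ::
    "'a::euclidean_space measure \<Rightarrow> 'a measure \<Rightarrow> ('a \<times> 'a) measure set" where
  "couplings \<mu> \<nu> = {\<pi>. prob_space \<pi> \<and> sets \<pi> = sets (borel \<Otimes>\<^sub>M borel) \<and>
      distr \<pi> borel fst = \<mu> \<and> distr \<pi> borel snd = \<nu>}"

text \<open>
  The infimum is taken in the extended nonnegative reals, where an infinite cost counts as
  infinity. On \<^const>\<open>P2\<close> it is finite (the product coupling has finite cost), so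
  \<^const>\<open>enn2real\<close> loses nothing there; outside \<^const>\<open>P2\<close> the value carries no meaning.
\<close>

definition W2 :: "'a::euclidean_space measure \<Rightarrow> 'a measure \<Rightarrow> real" where
  "W2 \<mu> \<nu> = sqrt (enn2real (INF \<pi>\<in>couplings \<mu> \<nu>.
      \<integral>\<^sup>+ z. ennreal ((norm (fst z - snd z))\<^sup>2) \<partial>\<pi>))"

text \<open>The sets that contain, with each point, a \<^const>\<open>W2\<close>-ball around it. The constant is used
  outside its locale, so no metric axiom is presupposed by the definition.\<close>

definition W2_topology :: "'a::euclidean_space measure topology" where
  "W2_topology = Metric_space.mtopology P2 W2"

definition relatively_compact_in :: "'b topology \<Rightarrow> 'b set \<Rightarrow> bool" where
  "relatively_compact_in T S \<longleftrightarrow> S \<subseteq> topspace T \<and> compactin T (T closure_of S)"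

text \<open>Limit points of a sequence are the limits of its subsequences (not the accumulation
  points of its range: the limit of a constant sequence is a limit point).\<close>

definition sequence_limit_point :: "'b topology \<Rightarrow> (nat \<Rightarrow> 'b) \<Rightarrow> 'b \<Rightarrow> bool" where
  "sequence_limit_point T s l \<longleftrightarrow> (\<exists>r. strict_mono r \<and> limitin T (s \<circ> r) l sequentially)"

definition is_barycenter ::
    "nat \<Rightarrow> (nat \<Rightarrow> 'a::euclidean_space measure) \<Rightarrow> (nat \<Rightarrow> real) \<Rightarrow> 'a measure \<Rightarrow> bool" where
  "is_barycenter J \<nu> w \<mu> \<longleftrightarrow> \<mu> \<in> P2 \<and>
     (\<forall>\<rho>\<in>P2. (\<Sum>j=1..J. w j * (W2 \<mu> (\<nu> j))\<^sup>2) \<le> (\<Sum>j=1..J. w j * (W2 \<rho> (\<nu> j))\<^sup>2))"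

end

theory Submission
  imports Defs
begin

text \<open>
  Comparing the barycenters with a fixed competitor bounds their second moments, so a subsequence
  converges weakly to some \<open>\<sigma>\<close>. Since \<open>W2\<close> is weakly lower semicontinuous and the optimal values
  converge, \<open>\<sigma>\<close> is a barycenter of the limits and each \<open>W2 (\<mu>B n) (\<mu> j)\<close> converges to \<open>W2 \<sigma> (\<mu> j)\<close>.
  Weak convergence together with convergence of the distance to a single measure forces convergence
  in \<open>W2\<close>: along almost surely convergent near-optimal couplings Fatou's lemma, applied to
  \<open>3 |X n - Y n|\<^sup>2 + 3 |Y n|\<^sup>2 + 3 |X|\<^sup>2 - |X n - X|\<^sup>2\<close>, leaves no room for the last term.

  Weak limits of measures and of couplings come with almost surely convergent random variables. They
  are obtained from Helly's and Skorohod's theorems on the real line by means of a space-filling map.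
  The triangle inequality avoids disintegration: two couplings are glued along a countable partition
  of the middle space into small cells.
\<close>

text \<open>A bound on second moments gives tightness but no uniform integrability: a vanishing mass
  can escape to infinity and carry a fixed amount of second moment away. A weak limit therefore says
  nothing yet about \<open>W2\<close>, and minimality has to rule out such a loss. It does so
  because lower semicontinuity bounds each single distance from one side while optimality bounds
  their weighted sum from the other; with positive weights no single distance can drop in the limit.
  The coefficients 3 come from \<open>|a + b + c|\<^sup>2 \<le> 3 (|a|\<^sup>2 + |b|\<^sup>2 +
  |c|\<^sup>2)\<close> applied to \<open>X n - X = (X n - Y n) + Y n - X\<close>, which keeps the
  integrand of Fatou's lemma nonnegative. The moving measures \<open>\<mu>n n j\<close> are
  exchanged for their limits at a cost of at most \<open>W2 (\<mu>n n j) (\<mu> j)\<close>, which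
  tends to 0 whatever the other argument of the distance is.\<close>

section \<open>The Wasserstein distance\<close>

text \<open>
  The glued measure is the density of the product \<open>P \<Otimes>\<^sub>M Q\<close> that renormalises each diagonal
  block \<open>{u = i} \<times> {v = i}\<close> by its common mass.
\<close>

lemma glue_along_countable:
  fixes u :: "'p \<Rightarrow> nat" and v :: "'q \<Rightarrow> nat"
  assumes P: "prob_space P" and Q: "prob_space Q"
    and u[measurable]: "u \<in> P \<rightarrow>\<^sub>M count_space UNIV"
    and v[measurable]: "v \<in> Q \<rightarrow>\<^sub>M count_space UNIV"
    and eq: "distr P (count_space UNIV) u = distr Q (count_space UNIV) v"
  obtains T where "prob_space T" "sets T = sets (P \<Otimes>\<^sub>M Q)"
    "distr T P fst = P" "distr T Q snd = Q" "AE z in T. u (fst z) = v (snd z)"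
proof -
  interpret P: prob_space P by fact
  interpret Q: prob_space Q by fact
  interpret PQ: pair_prob_space P Q ..
  define m where "m i = measure P {x\<in>space P. u x = i}" for i
  have mP: "emeasure P {x\<in>space P. u x = i} = ennreal (m i)" for i
    unfolding m_def by (rule P.emeasure_eq_measure)
  have mQ: "emeasure Q {x\<in>space Q. v x = i} = ennreal (m i)" for i
  proof -
    have "emeasure Q {x\<in>space Q. v x = i} = emeasure (distr Q (count_space UNIV) v) {i}"
      by (subst emeasure_distr) (auto intro!: arg_cong[where f="emeasure Q"])
    also have "\<dots> = emeasure P {x\<in>space P. u x = i}"
      unfolding eq[symmetric]
      by (subst emeasure_distr) (auto intro!: arg_cong[where f="emeasure P"])
    finally show ?thesis using mP by simp
  qed
  \<comment> \<open>Where \<open>m (u x) = 0\<close> the quotient is 0 by the convention for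
    division; such \<open>x\<close> form a null set.\<close>
  define g where "g x = ennreal (1 / m (u x))" for x
  have [measurable]: "g \<in> borel_measurable P"
    unfolding g_def by (rule measurable_compose[OF u]) simp
  define h :: "'p \<times> 'q \<Rightarrow> ennreal"
    where "h z = (if u (fst z) = v (snd z) then g (fst z) else 0)" for z
  have h[measurable]: "h \<in> borel_measurable (P \<Otimes>\<^sub>M Q)"
  proof -
    \<comment> \<open>The diagonal \<open>u = v\<close> is a countable union of measurable
      rectangles, one for each label \<open>i\<close>.\<close>
    have "Measurable.pred (P \<Otimes>\<^sub>M Q) (\<lambda>z. \<exists>i. u (fst z) = i \<and> v (snd z) = i)" by measurable
    then have [measurable]: "Measurable.pred (P \<Otimes>\<^sub>M Q) (\<lambda>z. u (fst z) = v (snd z))"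
      by (simp add: eq_commute)
    show ?thesis unfolding h_def by measurable
  qed
  define T where "T = density (P \<Otimes>\<^sub>M Q) h"
  have sT: "sets T = sets (P \<Otimes>\<^sub>M Q)" and spT: "space T = space P \<times> space Q"
    unfolding T_def by (simp_all add: space_pair_measure)
  have AEP: "AE x in P. m (u x) \<noteq> 0"
  proof -
    have "AE x in P. m i = 0 \<longrightarrow> u x \<noteq> i" for i
    proof (cases "m i = 0")
      case True
      then have "emeasure P {x\<in>space P. u x = i} = 0" using mP by simp
      then have "AE x in P. u x \<noteq> i" by (intro AE_I[where N="{x\<in>space P. u x = i}"]) auto
      then show ?thesis by auto
    qed simp
    then have "AE x in P. \<forall>i. m i = 0 \<longrightarrow> u x \<noteq> i" by (simp add: AE_all_countable)
    then show ?thesis by eventually_elim auto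
  qed
  have AEQ: "AE x in Q. m (v x) \<noteq> 0"
  proof -
    have "AE x in Q. m i = 0 \<longrightarrow> v x \<noteq> i" for i
    proof (cases "m i = 0")
      case True
      then have "emeasure Q {x\<in>space Q. v x = i} = 0" using mQ by simp
      then have "AE x in Q. v x \<noteq> i" by (intro AE_I[where N="{x\<in>space Q. v x = i}"]) auto
      then show ?thesis by auto
    qed simp
    then have "AE x in Q. \<forall>i. m i = 0 \<longrightarrow> v x \<noteq> i" by (simp add: AE_all_countable)
    then show ?thesis by eventually_elim auto
  qed
  have one: "ennreal (1 / m i) * ennreal (m i) = 1" if "m i \<noteq> 0" for i
    using that by (simp add: ennreal_mult[symmetric] m_def)
  have intQ: "(\<integral>\<^sup>+ y. h (x, y) \<partial>Q) = 1" if "m (u x) \<noteq> 0" for x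
  proof -
    have "(\<integral>\<^sup>+ y. h (x, y) \<partial>Q)
        = (\<integral>\<^sup>+ y. ennreal (1 / m (u x)) * indicator {y\<in>space Q. v y = u x} y \<partial>Q)"
      by (intro nn_integral_cong) (auto simp: h_def g_def indicator_def)
    also have "\<dots> = ennreal (1 / m (u x)) * ennreal (m (u x))"
      by (subst nn_integral_cmult_indicator) (auto simp: mQ)
    finally show ?thesis using one[OF that] by simp
  qed
  have intP: "(\<integral>\<^sup>+ x. h (x, y) \<partial>P) = 1" if "m (v y) \<noteq> 0" for y
  proof -
    have "(\<integral>\<^sup>+ x. h (x, y) \<partial>P)
        = (\<integral>\<^sup>+ x. ennreal (1 / m (v y)) * indicator {x\<in>space P. u x = v y} x \<partial>P)"
      by (intro nn_integral_cong) (auto simp: h_def g_def indicator_def)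
    also have "\<dots> = ennreal (1 / m (v y)) * ennreal (m (v y))"
      by (subst nn_integral_cmult_indicator) (auto simp: mP)
    finally show ?thesis using one[OF that] by simp
  qed
  have fstT: "distr T P fst = P"
  proof (rule measure_eqI)
    fix A assume "A \<in> sets (distr T P fst)"
    then have A[measurable]: "A \<in> sets P" by simp
    have "emeasure (distr T P fst) A = emeasure T (A \<times> space Q)"
      using sets.sets_into_space[OF A]
      by (subst emeasure_distr) (auto simp: T_def space_pair_measure intro!: arg_cong[where f="emeasure _"])
    also have "\<dots> = (\<integral>\<^sup>+ z. h z * indicator (A \<times> space Q) z \<partial>(P \<Otimes>\<^sub>M Q))"
      unfolding T_def by (rule emeasure_density) auto
    also have "\<dots> = (\<integral>\<^sup>+ x. \<integral>\<^sup>+ y. h (x,y) * indicator (A \<times> space Q) (x,y) \<partial>Q \<partial>P)"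
      by (rule Q.nn_integral_fst[symmetric]) auto
    also have "\<dots> = (\<integral>\<^sup>+ x. \<integral>\<^sup>+ y. h (x,y) * indicator A x \<partial>Q \<partial>P)"
      by (intro nn_integral_cong) (auto simp: indicator_def)
    also have "\<dots> = (\<integral>\<^sup>+ x. indicator A x \<partial>P)"
      using AEP by (intro nn_integral_cong_AE) (auto elim!: eventually_mono simp: nn_integral_multc intQ)
    finally show "emeasure (distr T P fst) A = emeasure P A" by simp
  qed simp
  have sndT: "distr T Q snd = Q"
  proof (rule measure_eqI)
    fix A assume "A \<in> sets (distr T Q snd)"
    then have A[measurable]: "A \<in> sets Q" by simp
    have "emeasure (distr T Q snd) A = emeasure T (space P \<times> A)"
      using sets.sets_into_space[OF A]
      by (subst emeasure_distr) (auto simp: T_def space_pair_measure intro!: arg_cong[where f="emeasure _"])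
    also have "\<dots> = (\<integral>\<^sup>+ z. h z * indicator (space P \<times> A) z \<partial>(P \<Otimes>\<^sub>M Q))"
      unfolding T_def by (rule emeasure_density) auto
    also have "\<dots> = (\<integral>\<^sup>+ y. \<integral>\<^sup>+ x. h (x,y) * indicator (space P \<times> A) (x,y) \<partial>P \<partial>Q)"
      by (rule PQ.nn_integral_snd[symmetric]) auto
    also have "\<dots> = (\<integral>\<^sup>+ y. \<integral>\<^sup>+ x. h (x,y) * indicator A y \<partial>P \<partial>Q)"
      by (intro nn_integral_cong) (auto simp: indicator_def)
    also have "\<dots> = (\<integral>\<^sup>+ y. indicator A y \<partial>Q)"
      using AEQ by (intro nn_integral_cong_AE) (auto elim!: eventually_mono simp: nn_integral_multc intP)
    finally show "emeasure (distr T Q snd) A = emeasure Q A" by simp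
  qed simp
  have [measurable]: "fst \<in> T \<rightarrow>\<^sub>M P" unfolding T_def by simp
  have "prob_space (distr T P fst)" unfolding fstT by fact
  then have "prob_space T" by (rule prob_space_distrD[rotated]) simp
  moreover have "AE z in T. u (fst z) = v (snd z)"
    unfolding T_def by (subst AE_density) (auto simp: h_def)
  ultimately show thesis using that sT fstT sndT by blast
qed

text \<open>A point gets the index of the first member of a dense sequence within distance
  \<open>e / 2\<close>, so points with equal index are near the same centre. Countably many cells
  are what the gluing needs.\<close>

lemma countable_partition_small:
  fixes e :: real
  assumes "e > 0"
  obtains c :: "'a::euclidean_space \<Rightarrow> nat" where "c \<in> borel \<rightarrow>\<^sub>M count_space UNIV"
    "\<And>x y. c x = c y \<Longrightarrow> norm (x - y) \<le> e"
proof -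
  obtain D :: "'a set" where D: "countable D" "\<And>X. open X \<Longrightarrow> X \<noteq> {} \<Longrightarrow> \<exists>d\<in>D. d \<in> X"
    by (rule countable_dense_setE) blast
  have "D \<noteq> {}" using D(2)[of UNIV] by auto
  define q where "q = from_nat_into D"
  have q: "\<exists>i. dist (q i) x < e / 2" for x
  proof -
    obtain d where "d \<in> D" "d \<in> ball x (e/2)" using D(2)[of "ball x (e/2)"] assms by auto
    moreover obtain i where "q i = d"
      using from_nat_into_surj[OF D(1) \<open>d \<in> D\<close>] unfolding q_def by auto
    ultimately show ?thesis by (auto simp: dist_commute)
  qed
  define c where "c x = (LEAST i. dist (q i) x < e / 2)" for x
  have c: "dist (q (c x)) x < e / 2" for x
    unfolding c_def by (rule LeastI_ex[OF q])
  show thesis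
  proof (rule that)
    show "c \<in> borel \<rightarrow>\<^sub>M count_space UNIV" unfolding c_def by measurable
    fix x y assume "c x = c y"
    then have "dist (q (c x)) x < e / 2" "dist (q (c x)) y < e / 2" using c[of x] c[of y] by simp_all
    then have "dist x y < e" by (rule dist_triangle_half_r)
    then show "norm (x - y) \<le> e" by (simp add: dist_norm)
  qed
qed

section \<open>Couplings, near-optimal couplings and the triangle inequality for
  \<open>W2\<close>\<close>

lemma P2D:
  assumes "\<mu> \<in> P2"
  shows "prob_space \<mu>" "sets \<mu> = sets borel" "(\<integral>\<^sup>+ x. ennreal ((norm x)\<^sup>2) \<partial>\<mu>) < \<infinity>"
  using assms unfolding P2_def by auto

lemma W2_nonneg [simp]: "0 \<le> W2 \<mu> \<nu>"
  unfolding W2_def by simp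

text \<open>The joint law of \<open>X\<close> and \<open>Y\<close> is a coupling of their laws.
  Upper bounds on \<open>W2\<close> are thus proved by exhibiting random variables on a common
  probability space.\<close>

lemma W2_le:
  fixes X Y :: "'w \<Rightarrow> 'a::euclidean_space"
  assumes \<Omega>: "prob_space \<Omega>" and [measurable]: "X \<in> borel_measurable \<Omega>" "Y \<in> borel_measurable \<Omega>"
    and le: "(\<integral>\<^sup>+ \<omega>. ennreal ((norm (X \<omega> - Y \<omega>))\<^sup>2) \<partial>\<Omega>) \<le> ennreal (a\<^sup>2)" and a: "0 \<le> a"
  shows "W2 (distr \<Omega> borel X) (distr \<Omega> borel Y) \<le> a"
proof -
  define \<pi> where "\<pi> = distr \<Omega> (borel \<Otimes>\<^sub>M borel) (\<lambda>\<omega>. (X \<omega>, Y \<omega>))"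
  have "\<pi> \<in> couplings (distr \<Omega> borel X) (distr \<Omega> borel Y)"
    unfolding couplings_def \<pi>_def
    by (auto simp: distr_distr comp_def intro!: prob_space.prob_space_distr \<Omega>)
  then have "(INF \<pi>\<in>couplings (distr \<Omega> borel X) (distr \<Omega> borel Y).
      \<integral>\<^sup>+ z. ennreal ((norm (fst z - snd z))\<^sup>2) \<partial>\<pi>) \<le> (\<integral>\<^sup>+ z. ennreal ((norm (fst z - snd z))\<^sup>2) \<partial>\<pi>)"
    by (rule INF_lower)
  also have "\<dots> = (\<integral>\<^sup>+ \<omega>. ennreal ((norm (X \<omega> - Y \<omega>))\<^sup>2) \<partial>\<Omega>)"
    unfolding \<pi>_def by (subst nn_integral_distr) auto
  also note le
  finally have "enn2real (INF \<pi>\<in>couplings (distr \<Omega> borel X) (distr \<Omega> borel Y).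
      \<integral>\<^sup>+ z. ennreal ((norm (fst z - snd z))\<^sup>2) \<partial>\<pi>) \<le> a\<^sup>2"
    by (intro enn2real_leI) auto
  then have "W2 (distr \<Omega> borel X) (distr \<Omega> borel Y) \<le> sqrt (a\<^sup>2)"
    unfolding W2_def by (rule real_sqrt_le_mono)
  then show ?thesis using a by simp
qed

lemma norm_diff_sq_le: "(norm (x - y))\<^sup>2 \<le> 2 * (norm x)\<^sup>2 + 2 * (norm y)\<^sup>2"
  for x y :: "'a::real_normed_vector"
proof -
  have "(norm (x - y))\<^sup>2 \<le> (norm x + norm y)\<^sup>2"
    by (intro power_mono norm_triangle_ineq4) simp
  also have "\<dots> \<le> 2 * (norm x)\<^sup>2 + 2 * (norm y)\<^sup>2"
    using sum_squares_bound[of "norm x" "norm y"] by (simp add: power2_sum)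
  finally show ?thesis .
qed

text \<open>\<open>enn2real\<close> sends infinity to 0, so a bound on \<open>W2\<close> says
  something about the infimum only when that infimum is finite. The product measure is a coupling of
  finite cost.\<close>

lemma cost_finite:
  fixes \<mu> \<nu> :: "'a::euclidean_space measure"
  assumes \<mu>: "\<mu> \<in> P2" and \<nu>: "\<nu> \<in> P2"
  shows "(INF \<pi>\<in>couplings \<mu> \<nu>. \<integral>\<^sup>+ z. ennreal ((norm (fst z - snd z))\<^sup>2) \<partial>\<pi>) < \<infinity>"
proof -
  note [measurable_cong] = P2D(2)[OF \<mu>] P2D(2)[OF \<nu>]
  interpret m: prob_space \<mu> by (rule P2D(1)[OF \<mu>])
  interpret n: prob_space \<nu> by (rule P2D(1)[OF \<nu>])
  interpret mn: pair_prob_space \<mu> \<nu> ..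
  have f: "distr (\<mu> \<Otimes>\<^sub>M \<nu>) borel fst = \<mu>"
    using n.distr_pair_fst[of \<mu>] distr_cong[OF refl P2D(2)[OF \<mu>] refl] by metis
  have s: "distr (\<mu> \<Otimes>\<^sub>M \<nu>) borel snd = \<nu>"
  proof -
    have "distr (\<mu> \<Otimes>\<^sub>M \<nu>) borel snd = distr (distr (\<nu> \<Otimes>\<^sub>M \<mu>) (\<mu> \<Otimes>\<^sub>M \<nu>) (\<lambda>(x, y). (y, x))) borel snd"
      by (subst mn.distr_pair_swap) simp
    also have "\<dots> = distr (\<nu> \<Otimes>\<^sub>M \<mu>) borel fst"
      by (subst distr_distr) (auto simp: comp_def split_beta')
    also have "\<dots> = \<nu>" using m.distr_pair_fst[of \<nu>] distr_cong[OF refl P2D(2)[OF \<nu>] refl] by metis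
    finally show ?thesis .
  qed
  have "\<mu> \<Otimes>\<^sub>M \<nu> \<in> couplings \<mu> \<nu>"
    unfolding couplings_def using f s mn.prob_space_axioms
    by (auto intro!: sets_pair_measure_cong P2D \<mu> \<nu>)
  then have "(INF \<pi>\<in>couplings \<mu> \<nu>. \<integral>\<^sup>+ z. ennreal ((norm (fst z - snd z))\<^sup>2) \<partial>\<pi>)
      \<le> (\<integral>\<^sup>+ z. ennreal ((norm (fst z - snd z))\<^sup>2) \<partial>(\<mu> \<Otimes>\<^sub>M \<nu>))" by (rule INF_lower)
  also have "\<dots> \<le> (\<integral>\<^sup>+ z. 2 * ennreal ((norm (fst z))\<^sup>2) + 2 * ennreal ((norm (snd z))\<^sup>2) \<partial>(\<mu> \<Otimes>\<^sub>M \<nu>))"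
  proof (rule nn_integral_mono)
    fix z :: "'a \<times> 'a"
    have "ennreal ((norm (fst z - snd z))\<^sup>2) \<le> ennreal (2 * (norm (fst z))\<^sup>2 + 2 * (norm (snd z))\<^sup>2)"
      by (intro ennreal_leI norm_diff_sq_le)
    then show "ennreal ((norm (fst z - snd z))\<^sup>2)
        \<le> 2 * ennreal ((norm (fst z))\<^sup>2) + 2 * ennreal ((norm (snd z))\<^sup>2)"
      by (simp add: ennreal_mult)
  qed
  also have "\<dots> = 2 * (\<integral>\<^sup>+ z. ennreal ((norm (fst z))\<^sup>2) \<partial>(\<mu> \<Otimes>\<^sub>M \<nu>))
      + 2 * (\<integral>\<^sup>+ z. ennreal ((norm (snd z))\<^sup>2) \<partial>(\<mu> \<Otimes>\<^sub>M \<nu>))"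
    by (subst nn_integral_add) (auto simp: nn_integral_cmult)
  also have "(\<integral>\<^sup>+ z. ennreal ((norm (fst z))\<^sup>2) \<partial>(\<mu> \<Otimes>\<^sub>M \<nu>)) = (\<integral>\<^sup>+ x. ennreal ((norm x)\<^sup>2) \<partial>\<mu>)"
    using nn_integral_distr[of fst "\<mu> \<Otimes>\<^sub>M \<nu>" borel "\<lambda>x. ennreal ((norm x)\<^sup>2)"] by (simp add: f)
  also have "(\<integral>\<^sup>+ z. ennreal ((norm (snd z))\<^sup>2) \<partial>(\<mu> \<Otimes>\<^sub>M \<nu>)) = (\<integral>\<^sup>+ x. ennreal ((norm x)\<^sup>2) \<partial>\<nu>)"
    using nn_integral_distr[of snd "\<mu> \<Otimes>\<^sub>M \<nu>" borel "\<lambda>x. ennreal ((norm x)\<^sup>2)"] by (simp add: s)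
  also have "2 * (\<integral>\<^sup>+ x. ennreal ((norm x)\<^sup>2) \<partial>\<mu>) + 2 * (\<integral>\<^sup>+ x. ennreal ((norm x)\<^sup>2) \<partial>\<nu>) < \<infinity>"
    using P2D(3)[OF \<mu>] P2D(3)[OF \<nu>] by (simp add: ennreal_mult_less_top)
  finally show ?thesis .
qed

text \<open>A strict bound on an infimum is beaten by one of its members, so a coupling below the
  bound exists whether or not the infimum is attained.\<close>

lemma W2_lessE:
  fixes \<mu> \<nu> :: "'a::euclidean_space measure"
  assumes \<mu>: "\<mu> \<in> P2" and \<nu>: "\<nu> \<in> P2" and a: "W2 \<mu> \<nu> < a"
  obtains \<pi> where "prob_space \<pi>" "sets \<pi> = sets (borel \<Otimes>\<^sub>M borel)"
    "distr \<pi> borel fst = \<mu>" "distr \<pi> borel snd = \<nu>"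
    "(\<integral>\<^sup>+ z. ennreal ((norm (fst z - snd z))\<^sup>2) \<partial>\<pi>) \<le> ennreal (a\<^sup>2)"
proof -
  let ?I = "INF \<pi>\<in>couplings \<mu> \<nu>. \<integral>\<^sup>+ z. ennreal ((norm (fst z - snd z))\<^sup>2) \<partial>\<pi>"
  have "0 < a" using a W2_nonneg[of \<mu> \<nu>] by linarith
  have "sqrt (enn2real ?I) < a" using a unfolding W2_def .
  then have "enn2real ?I < a\<^sup>2"
    using real_sqrt_less_iff[of "enn2real ?I" "a\<^sup>2"] \<open>0 < a\<close> by simp
  moreover have "?I = ennreal (enn2real ?I)" using cost_finite[OF \<mu> \<nu>] by simp
  ultimately have "?I < ennreal (a\<^sup>2)"
    using ennreal_lessI[of "a\<^sup>2" "enn2real ?I"] \<open>0 < a\<close> by simp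
  then obtain \<pi> where "\<pi> \<in> couplings \<mu> \<nu>"
    "(\<integral>\<^sup>+ z. ennreal ((norm (fst z - snd z))\<^sup>2) \<partial>\<pi>) < ennreal (a\<^sup>2)"
    unfolding INF_less_iff by blast
  then show thesis using that[of \<pi>] unfolding couplings_def by simp
qed

lemma W2_commute: "W2 \<mu> \<nu> = W2 \<nu> \<mu>"
  for \<mu> \<nu> :: "'a::euclidean_space measure"
proof -
  let ?I = "\<lambda>\<mu> \<nu> :: 'a measure. INF \<pi>\<in>couplings \<mu> \<nu>. \<integral>\<^sup>+ z. ennreal ((norm (fst z - snd z))\<^sup>2) \<partial>\<pi>"
  have "?I \<nu> \<mu> \<le> ?I \<mu> \<nu>" for \<mu> \<nu> :: "'a measure"
  proof (rule INF_greatest)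
    fix \<pi> assume \<pi>: "\<pi> \<in> couplings \<mu> \<nu>"
    then have [measurable_cong]: "sets \<pi> = sets (borel \<Otimes>\<^sub>M borel)" by (simp add: couplings_def)
    define \<pi>' where "\<pi>' = distr \<pi> (borel \<Otimes>\<^sub>M borel) (\<lambda>z. (snd z, fst z))"
    have "\<pi>' \<in> couplings \<nu> \<mu>" using \<pi> unfolding couplings_def \<pi>'_def
      by (auto simp: distr_distr comp_def intro!: prob_space.prob_space_distr)
    then have "?I \<nu> \<mu> \<le> (\<integral>\<^sup>+ z. ennreal ((norm (fst z - snd z))\<^sup>2) \<partial>\<pi>')" by (rule INF_lower)
    also have "\<dots> = (\<integral>\<^sup>+ z. ennreal ((norm (fst z - snd z))\<^sup>2) \<partial>\<pi>)"
      unfolding \<pi>'_def by (subst nn_integral_distr) (auto simp: norm_minus_commute)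
    finally show "?I \<nu> \<mu> \<le> (\<integral>\<^sup>+ z. ennreal ((norm (fst z - snd z))\<^sup>2) \<partial>\<pi>)" .
  qed
  then have "?I \<mu> \<nu> = ?I \<nu> \<mu>" by (intro antisym)
  then show ?thesis unfolding W2_def by simp
qed

text \<open>Cauchy-Schwarz in three terms; the difference of the two sides is a sum of squares by
  Lagrange's identity. Equal weights give the factor 3; weights equal to the
  \<open>L\<^sup>2\<close> bounds of the terms give Minkowski's inequality with its sharp
  constant.\<close>

lemma add3_sq_le_weighted:
  fixes a b c p q r :: real
  assumes "p > 0" "q > 0" "r > 0"
  shows "(a + b + c)\<^sup>2 \<le> (p + q + r) * (a\<^sup>2 / p + b\<^sup>2 / q + c\<^sup>2 / r)"
proof -
  have "(p + q + r) * (a\<^sup>2 / p + b\<^sup>2 / q + c\<^sup>2 / r) - (a + b + c)\<^sup>2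
      = (q * a - p * b)\<^sup>2 / (p * q) + (r * a - p * c)\<^sup>2 / (p * r) + (r * b - q * c)\<^sup>2 / (q * r)"
    using assms by (simp add: field_simps power2_eq_square)
  also have "\<dots> \<ge> 0" using assms by simp
  finally show ?thesis by simp
qed

text \<open>Two near-optimal couplings glued along a partition give a path \<open>x\<close>,
  \<open>y\<close>, \<open>y'\<close>, \<open>z\<close> whose middle leg stays inside one cell.
  Taking the bounds \<open>p\<close>, \<open>q\<close>, \<open>r\<close> of the legs as weights
  makes the estimate add up to exactly \<open>(p + q + r)\<^sup>2\<close>.\<close>

lemma W2_triangle:
  fixes \<mu> \<nu> \<rho> :: "'a::euclidean_space measure"
  assumes \<mu>: "\<mu> \<in> P2" and \<nu>: "\<nu> \<in> P2" and \<rho>: "\<rho> \<in> P2"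
  shows "W2 \<mu> \<rho> \<le> W2 \<mu> \<nu> + W2 \<nu> \<rho>"
proof (rule field_le_epsilon)
  fix e :: real assume "0 < e"
  \<comment> \<open>One third of \<open>e\<close> pays for each coupling that is only near-optimal
    and one third for the size of the cells; it also keeps the three weights positive.\<close>
  define p where "p = W2 \<mu> \<nu> + e / 3"
  define r where "r = W2 \<nu> \<rho> + e / 3"
  define q where "q = e / 3"
  have pqr: "p > 0" "q > 0" "r > 0" using \<open>0 < e\<close> unfolding p_def q_def r_def
    by (auto intro!: add_nonneg_pos)
  obtain \<pi> where \<pi>: "prob_space \<pi>" "sets \<pi> = sets (borel \<Otimes>\<^sub>M borel)"
    "distr \<pi> borel fst = \<mu>" "distr \<pi> borel snd = \<nu>"
    "(\<integral>\<^sup>+ z. ennreal ((norm (fst z - snd z))\<^sup>2) \<partial>\<pi>) \<le> ennreal (p\<^sup>2)"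
    using W2_lessE[OF \<mu> \<nu>, of p] \<open>0 < e\<close> unfolding p_def by auto
  obtain \<sigma> where \<sigma>: "prob_space \<sigma>" "sets \<sigma> = sets (borel \<Otimes>\<^sub>M borel)"
    "distr \<sigma> borel fst = \<nu>" "distr \<sigma> borel snd = \<rho>"
    "(\<integral>\<^sup>+ z. ennreal ((norm (fst z - snd z))\<^sup>2) \<partial>\<sigma>) \<le> ennreal (r\<^sup>2)"
    using W2_lessE[OF \<nu> \<rho>, of r] \<open>0 < e\<close> unfolding r_def by auto
  note [measurable_cong] = \<pi>(2) \<sigma>(2)
  obtain c :: "'a \<Rightarrow> nat" where c[measurable]: "c \<in> borel \<rightarrow>\<^sub>M count_space UNIV"
    and cq: "\<And>x y. c x = c y \<Longrightarrow> norm (x - y) \<le> q"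
    using countable_partition_small[OF pqr(2)] by blast
  \<comment> \<open>Both laws are the image of \<open>\<nu>\<close> under the cell index.\<close>
  have "distr \<pi> (count_space UNIV) (\<lambda>z. c (snd z)) = distr (distr \<pi> borel snd) (count_space UNIV) c"
    by (subst distr_distr) (auto simp: comp_def)
  also have "\<dots> = distr (distr \<sigma> borel fst) (count_space UNIV) c" using \<pi> \<sigma> by simp
  also have "\<dots> = distr \<sigma> (count_space UNIV) (\<lambda>z. c (fst z))"
    by (subst distr_distr) (auto simp: comp_def)
  finally have eq: "distr \<pi> (count_space UNIV) (\<lambda>z. c (snd z))
      = distr \<sigma> (count_space UNIV) (\<lambda>z. c (fst z))" .
  have "(\<lambda>z. c (snd z)) \<in> \<pi> \<rightarrow>\<^sub>M count_space UNIV" "(\<lambda>z. c (fst z)) \<in> \<sigma> \<rightarrow>\<^sub>M count_space UNIV"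
    by measurable
  from glue_along_countable[OF \<pi>(1) \<sigma>(1) this eq] obtain T where T: "prob_space T" "sets T = sets (\<pi> \<Otimes>\<^sub>M \<sigma>)"
    "distr T \<pi> fst = \<pi>" "distr T \<sigma> snd = \<sigma>" "AE z in T. c (snd (fst z)) = c (fst (snd z))"
    by blast
  note [measurable_cong] = T(2)
  let ?x = "\<lambda>z :: ('a \<times> 'a) \<times> ('a \<times> 'a). fst (fst z)"
  let ?y = "\<lambda>z :: ('a \<times> 'a) \<times> ('a \<times> 'a). snd (fst z)"
  let ?y' = "\<lambda>z :: ('a \<times> 'a) \<times> ('a \<times> 'a). fst (snd z)"
  let ?z = "\<lambda>z :: ('a \<times> 'a) \<times> ('a \<times> 'a). snd (snd z)"
  have dx: "distr T borel ?x = \<mu>"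
    using distr_distr[of fst \<pi> borel fst T] T(3) \<pi>(3) by (simp add: comp_def)
  have dz: "distr T borel ?z = \<rho>"
    using distr_distr[of snd \<sigma> borel snd T] T(4) \<sigma>(4) by (simp add: comp_def)
  have cxy: "(\<integral>\<^sup>+ z. ennreal ((norm (?x z - ?y z))\<^sup>2) \<partial>T) \<le> ennreal (p\<^sup>2)"
    using \<pi>(5) nn_integral_distr[of fst T \<pi> "\<lambda>z. ennreal ((norm (fst z - snd z))\<^sup>2)"] by (simp add: T(3))
  have cyz: "(\<integral>\<^sup>+ z. ennreal ((norm (?y' z - ?z z))\<^sup>2) \<partial>T) \<le> ennreal (r\<^sup>2)"
    using \<sigma>(5) nn_integral_distr[of snd T \<sigma> "\<lambda>z. ennreal ((norm (fst z - snd z))\<^sup>2)"] by (simp add: T(4))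
  define S where "S = p + q + r"
  have S: "S > 0" using pqr unfolding S_def by simp
  interpret T: prob_space T by fact
  have "(\<integral>\<^sup>+ z. ennreal ((norm (?x z - ?z z))\<^sup>2) \<partial>T)
      \<le> (\<integral>\<^sup>+ z. ennreal (S / p) * ennreal ((norm (?x z - ?y z))\<^sup>2) + ennreal (S * q)
           + ennreal (S / r) * ennreal ((norm (?y' z - ?z z))\<^sup>2) \<partial>T)"
  proof (rule nn_integral_mono_AE, use T(5) in eventually_elim)
    case (elim z)
    have "norm (?x z - ?z z) = norm ((?x z - ?y z) + (?y z - ?y' z) + (?y' z - ?z z))" by simp
    also have "\<dots> \<le> norm (?x z - ?y z) + norm (?y z - ?y' z) + norm (?y' z - ?z z)"
      by (meson norm_triangle_ineq add_right_mono order_trans)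
    also have "\<dots> \<le> norm (?x z - ?y z) + q + norm (?y' z - ?z z)"
      using cq[OF elim] by simp
    finally have "(norm (?x z - ?z z))\<^sup>2 \<le> (norm (?x z - ?y z) + q + norm (?y' z - ?z z))\<^sup>2"
      by (intro power_mono) auto
    also have "\<dots> \<le> S * ((norm (?x z - ?y z))\<^sup>2 / p + q\<^sup>2 / q + (norm (?y' z - ?z z))\<^sup>2 / r)"
      unfolding S_def by (rule add3_sq_le_weighted[OF pqr])
    also have "\<dots> = S / p * (norm (?x z - ?y z))\<^sup>2 + S * q + S / r * (norm (?y' z - ?z z))\<^sup>2"
      using pqr by (simp add: field_simps power2_eq_square)
    finally show ?case using pqr S
      by (simp add: ennreal_mult[symmetric] ennreal_plus[symmetric] ennreal_leI del: ennreal_plus)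
  qed
  also have "\<dots> = ennreal (S / p) * (\<integral>\<^sup>+ z. ennreal ((norm (?x z - ?y z))\<^sup>2) \<partial>T) + ennreal (S * q)
           + ennreal (S / r) * (\<integral>\<^sup>+ z. ennreal ((norm (?y' z - ?z z))\<^sup>2) \<partial>T)"
    by (simp add: nn_integral_add nn_integral_cmult T.emeasure_space_1)
  also have "\<dots> \<le> ennreal (S / p) * ennreal (p\<^sup>2) + ennreal (S * q) + ennreal (S / r) * ennreal (r\<^sup>2)"
    by (intro add_mono mult_left_mono cxy cyz) auto
  also have "\<dots> = ennreal (S / p * p\<^sup>2 + S * q + S / r * r\<^sup>2)"
    using pqr S by (simp add: ennreal_mult[symmetric] ennreal_plus[symmetric] del: ennreal_plus)
  also have "S / p * p\<^sup>2 + S * q + S / r * r\<^sup>2 = S\<^sup>2"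
    using pqr by (simp add: S_def power2_eq_square field_simps)
  finally have "W2 (distr T borel ?x) (distr T borel ?z) \<le> S"
    using S by (intro W2_le[OF T(1)]) auto
  then show "W2 \<mu> \<rho> \<le> W2 \<mu> \<nu> + W2 \<nu> \<rho> + e" unfolding dx dz S_def p_def q_def r_def by simp
qed

lemma W2_self_eq_0:
  assumes "\<mu> \<in> P2" shows "W2 \<mu> \<mu> = 0"
proof -
  note [measurable_cong] = P2D(2)[OF assms]
  have "distr \<mu> borel (\<lambda>x. x) = \<mu>" by (rule distr_id2) (simp add: P2D(2)[OF assms])
  then have "W2 \<mu> \<mu> \<le> 0"
    using W2_le[of \<mu> "\<lambda>x. x" "\<lambda>x. x" 0] P2D(1)[OF assms] by simp
  then show ?thesis using W2_nonneg[of \<mu> \<mu>] by linarith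
qed

lemma second_moment_le:
  fixes \<mu> \<nu> :: "'a::euclidean_space measure"
  assumes \<mu>: "\<mu> \<in> P2" and \<nu>: "\<nu> \<in> P2" and a: "W2 \<mu> \<nu> < a"
  shows "(\<integral>\<^sup>+ x. ennreal ((norm x)\<^sup>2) \<partial>\<mu>) \<le> 2 * ennreal (a\<^sup>2) + 2 * (\<integral>\<^sup>+ x. ennreal ((norm x)\<^sup>2) \<partial>\<nu>)"
proof -
  obtain \<pi> where \<pi>: "prob_space \<pi>" "sets \<pi> = sets (borel \<Otimes>\<^sub>M borel)"
    "distr \<pi> borel fst = \<mu>" "distr \<pi> borel snd = \<nu>"
    "(\<integral>\<^sup>+ z. ennreal ((norm (fst z - snd z))\<^sup>2) \<partial>\<pi>) \<le> ennreal (a\<^sup>2)"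
    using W2_lessE[OF \<mu> \<nu> a] by blast
  note [measurable_cong] = \<pi>(2) P2D(2)[OF \<mu>] P2D(2)[OF \<nu>]
  have "(\<integral>\<^sup>+ x. ennreal ((norm x)\<^sup>2) \<partial>\<mu>) = (\<integral>\<^sup>+ z. ennreal ((norm (fst z))\<^sup>2) \<partial>\<pi>)"
    using nn_integral_distr[of fst \<pi> borel "\<lambda>x. ennreal ((norm x)\<^sup>2)"] by (simp add: \<pi>)
  also have "\<dots> \<le> (\<integral>\<^sup>+ z. 2 * ennreal ((norm (fst z - snd z))\<^sup>2) + 2 * ennreal ((norm (snd z))\<^sup>2) \<partial>\<pi>)"
  proof (rule nn_integral_mono)
    fix z :: "'a \<times> 'a"
    have "(norm (fst z))\<^sup>2 \<le> 2 * (norm (fst z - snd z))\<^sup>2 + 2 * (norm (snd z))\<^sup>2"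
      using norm_diff_sq_le[of "fst z - snd z" "- snd z"] by simp
    then have "ennreal ((norm (fst z))\<^sup>2) \<le> ennreal (2 * (norm (fst z - snd z))\<^sup>2 + 2 * (norm (snd z))\<^sup>2)"
      by (rule ennreal_leI)
    then show "ennreal ((norm (fst z))\<^sup>2)
        \<le> 2 * ennreal ((norm (fst z - snd z))\<^sup>2) + 2 * ennreal ((norm (snd z))\<^sup>2)"
      by (simp add: ennreal_mult)
  qed
  also have "\<dots> = 2 * (\<integral>\<^sup>+ z. ennreal ((norm (fst z - snd z))\<^sup>2) \<partial>\<pi>) + 2 * (\<integral>\<^sup>+ z. ennreal ((norm (snd z))\<^sup>2) \<partial>\<pi>)"
    by (simp add: nn_integral_add nn_integral_cmult)
  also have "(\<integral>\<^sup>+ z. ennreal ((norm (snd z))\<^sup>2) \<partial>\<pi>) = (\<integral>\<^sup>+ x. ennreal ((norm x)\<^sup>2) \<partial>\<nu>)"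
    using nn_integral_distr[of snd \<pi> borel "\<lambda>x. ennreal ((norm x)\<^sup>2)"] by (simp add: \<pi>)
  also have "2 * (\<integral>\<^sup>+ z. ennreal ((norm (fst z - snd z))\<^sup>2) \<partial>\<pi>) \<le> 2 * ennreal (a\<^sup>2)"
    by (intro mult_left_mono \<pi>) auto
  finally show ?thesis by (simp add: add_right_mono)
qed

section \<open>A space-filling map with a measurable section\<close>

text \<open>Digits are counted from 0, and digit \<open>k\<close> has weight
  \<open>1 / 2 ^ Suc k\<close>. The floors make measurability immediate and settle the choice of
  expansion for dyadic numbers.\<close>

definition binary_digit :: "nat \<Rightarrow> real \<Rightarrow> real" where
  "binary_digit k x = of_int (\<lfloor>2 ^ Suc k * x\<rfloor> - 2 * \<lfloor>2 ^ k * x\<rfloor>)"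

lemma binary_digit_measurable [measurable]: "binary_digit k \<in> borel_measurable borel"
  unfolding binary_digit_def by measurable

lemma binary_digit_cases: "binary_digit k x = 0 \<or> binary_digit k x = 1"
proof -
  define y where "y = 2 ^ k * x"
  have "\<lfloor>2 * y\<rfloor> = 2 * \<lfloor>y\<rfloor> \<or> \<lfloor>2 * y\<rfloor> = 2 * \<lfloor>y\<rfloor> + 1" by linarith
  then show ?thesis unfolding binary_digit_def y_def by (auto simp: mult.assoc)
qed

lemma binary_digit_sums:
  assumes "0 \<le> x" "x < 1"
  shows "(\<lambda>k. binary_digit k x / 2 ^ Suc k) sums x"
proof -
  \<comment> \<open>The sum telescopes to the truncation of \<open>x\<close> after \<open>n\<close>
    digits; \<open>0 \<le> x < 1\<close> makes the floor at \<open>n = 0\<close> vanish.\<close>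
  have part: "(\<Sum>k<n. binary_digit k x / 2 ^ Suc k) = of_int \<lfloor>2 ^ n * x\<rfloor> / 2 ^ n" for n
  proof (induction n)
    case 0
    have "\<lfloor>x\<rfloor> = 0" using assms by linarith
    then show ?case by simp
  next
    case (Suc n)
    then show ?case by (simp add: binary_digit_def field_simps)
  qed
  have "(\<lambda>n. of_int \<lfloor>2 ^ n * x\<rfloor> / 2 ^ n) \<longlonglongrightarrow> x"
  proof (rule tendsto_sandwich[OF _ _ _ tendsto_const])
    show "\<forall>\<^sub>F n in sequentially. x - (1 / 2) ^ n \<le> of_int \<lfloor>2 ^ n * x\<rfloor> / 2 ^ n"
    proof (intro always_eventually allI)
      fix n :: nat
      have "2 ^ n * x - 1 \<le> of_int \<lfloor>2 ^ n * x\<rfloor>" by linarith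
      then have "(2 ^ n * x - 1) / 2 ^ n \<le> of_int \<lfloor>2 ^ n * x\<rfloor> / 2 ^ n"
        by (rule divide_right_mono) simp
      then show "x - (1 / 2) ^ n \<le> of_int \<lfloor>2 ^ n * x\<rfloor> / 2 ^ n"
        by (simp add: diff_divide_distrib power_one_over)
    qed
    show "\<forall>\<^sub>F n in sequentially. of_int \<lfloor>2 ^ n * x\<rfloor> / 2 ^ n \<le> x"
    proof (intro always_eventually allI)
      fix n :: nat
      have "of_int \<lfloor>2 ^ n * x\<rfloor> \<le> 2 ^ n * x" by linarith
      then show "of_int \<lfloor>2 ^ n * x\<rfloor> / 2 ^ n \<le> x" by (simp add: field_simps)
    qed
    have "(\<lambda>n. x - (1 / 2) ^ n) \<longlonglongrightarrow> x - 0"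
      by (intro tendsto_diff tendsto_const LIMSEQ_realpow_zero) auto
    then show "(\<lambda>n. x - (1 / 2) ^ n) \<longlonglongrightarrow> x" by simp
  qed
  then show ?thesis unfolding sums_def part .
qed

text \<open>
  Schoenberg's construction: the wave is 0 on \<open>[0, 1/3]\<close> and 1 on \<open>[2/3, 1]\<close> and has period 2, so at
  \<open>3 ^ n * t\<close> it reads off the \<open>n\<close>-th digit of a point \<open>t\<close> of the Cantor set. All binary digits of all
  coordinates are interleaved into the digits of \<open>t\<close>.
\<close>

definition digit_wave :: "real \<Rightarrow> real" where
  "digit_wave u = max 0 (min 1 (1 / 2 - cos (pi * u)))"

lemma digit_wave_bounds: "0 \<le> digit_wave u" "digit_wave u \<le> 1"
  unfolding digit_wave_def by auto

text \<open>\<open>1 / 2\<close> is both \<open>cos (pi / 3)\<close> and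
  \<open>- cos (2 * pi / 3)\<close>, so the clipping in \<open>digit_wave\<close> saturates on the
  outer thirds of the unit interval.\<close>

lemma digit_wave_eq_0:
  assumes "0 \<le> u" "u \<le> 1 / 3" shows "digit_wave u = 0"
proof -
  have "pi * u \<le> pi * (1 / 3)" using assms by (intro mult_left_mono) auto
  then have "cos (pi * u) \<ge> cos (pi / 3)" using assms by (intro cos_monotone_0_pi_le) auto
  then show ?thesis unfolding digit_wave_def cos_60 by simp
qed

lemma digit_wave_eq_1:
  assumes "2 / 3 \<le> u" "u \<le> 1" shows "digit_wave u = 1"
proof -
  have "pi * (2 / 3) \<le> pi * u" "pi * u \<le> pi * 1" using assms by (intro mult_left_mono; auto)+
  then have "cos (pi * u) \<le> cos (pi * (2 / 3))" by (intro cos_monotone_0_pi_le) auto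
  moreover have "cos (pi * (2 / 3)) = - 1 / 2" using cos_120 by (simp add: mult.commute)
  ultimately show ?thesis unfolding digit_wave_def by simp
qed

lemma digit_wave_periodic: "digit_wave (2 * of_int N + u) = digit_wave u"
proof -
  have "cos (pi * (2 * of_int N + u)) = cos (pi * u)"
    using cos_add[of "2 * pi * of_int N" "pi * u"]
    unfolding cos_int_2pin sin_int_2pin by (simp add: algebra_simps)
  then show ?thesis unfolding digit_wave_def by simp
qed

text \<open>The base 3 digits are \<open>2 * a j\<close>, hence 0 or 2 when \<open>a\<close> is a
  bit sequence: this is a point of the Cantor set.\<close>

definition ternary :: "(nat \<Rightarrow> real) \<Rightarrow> real" where
  "ternary a = (\<Sum>j. 2 * a j / 3 ^ Suc j)"

lemma ternary_summable:
  fixes a :: "nat \<Rightarrow> real"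
  assumes a: "\<And>j. a j = 0 \<or> a j = 1"
  shows "summable (\<lambda>j. 2 * a j / 3 ^ Suc j)"
proof (rule summable_comparison_test')
  show "summable (\<lambda>j. (1 / 3 :: real) ^ j)" by (rule summable_geometric) simp
  show "norm (2 * a j / 3 ^ Suc j) \<le> (1 / 3) ^ j" for j
    using a[of j] by (auto simp: power_divide divide_simps)
qed

lemma ternary_shift:
  assumes a: "\<And>j. a j = 0 \<or> a j = 1"
  shows "3 * ternary a = 2 * a 0 + ternary (\<lambda>j. a (Suc j))"
proof -
  have "ternary a = (\<Sum>j. 2 * a (Suc j) / 3 ^ Suc (Suc j)) + 2 * a 0 / 3 ^ Suc 0"
    unfolding ternary_def using suminf_split_head[OF ternary_summable[of a]] a by simp
  also have "(\<Sum>j. 2 * a (Suc j) / 3 ^ Suc (Suc j)) = (\<Sum>j. (1 / 3) * (2 * a (Suc j) / 3 ^ Suc j))"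
    by (intro suminf_cong) simp
  also have "\<dots> = 1 / 3 * ternary (\<lambda>j. a (Suc j))"
    unfolding ternary_def by (rule suminf_mult) (rule ternary_summable, rule a)
  finally show ?thesis by simp
qed

lemma ternary_bounds:
  assumes a: "\<And>j. a j = 0 \<or> a j = 1"
  shows "0 \<le> ternary a" "ternary a \<le> 1"
proof -
  have nn: "0 \<le> 2 * a j / 3 ^ Suc j" for j using a[of j] by auto
  show "0 \<le> ternary a" unfolding ternary_def
    by (rule suminf_nonneg[OF ternary_summable[OF a] nn])
  have geo: "(\<lambda>j. 2 / 3 * (1 / 3 :: real) ^ j) sums (2 / 3 * (1 / (1 - 1 / 3)))"
    by (intro sums_mult geometric_sums) simp
  have "ternary a \<le> (\<Sum>j. 2 / 3 * (1 / 3 :: real) ^ j)" unfolding ternary_def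
  proof (rule suminf_le)
    show "2 * a j / 3 ^ Suc j \<le> 2 / 3 * (1 / 3) ^ j" for j
      using a[of j] by (auto simp: power_divide)
    show "summable (\<lambda>j. 2 * a j / 3 ^ Suc j)" by (rule ternary_summable[OF a])
    show "summable (\<lambda>j. 2 / 3 * (1 / 3 :: real) ^ j)" using geo by (rule sums_summable)
  qed
  also have "\<dots> = 1" using sums_unique[OF geo] by simp
  finally show "ternary a \<le> 1" .
qed

text \<open>Multiplication by \<open>3 ^ n\<close> moves the first \<open>n\<close> digits in front
  of the point. They are 0 or 2, so the integer they form is even and the period 2 of the wave
  discards it. The next digit decides in which outer third the remainder lies.\<close>

lemma digit_wave_ternary:
  assumes a: "\<And>j. a j = 0 \<or> a j = 1"
  shows "digit_wave (3 ^ n * ternary a) = a n"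
proof -
  have "\<exists>N :: int. 3 ^ n * ternary a = 2 * of_int N + ternary (\<lambda>j. a (n + j))"
  proof (induction n)
    case 0
    show ?case by (rule exI[of _ 0]) simp
  next
    case (Suc n)
    then obtain N :: int where N: "3 ^ n * ternary a = 2 * of_int N + ternary (\<lambda>j. a (n + j))" by blast
    obtain d :: int where d: "a n = of_int d" using a[of n] by (metis of_int_0 of_int_1)
    have "3 ^ Suc n * ternary a = 2 * of_int (3 * N) + 3 * ternary (\<lambda>j. a (n + j))"
      using N by simp
    also have "3 * ternary (\<lambda>j. a (n + j)) = 2 * a n + ternary (\<lambda>j. a (Suc n + j))"
      using ternary_shift[of "\<lambda>j. a (n + j)"] a by simp
    finally have "3 ^ Suc n * ternary a = 2 * of_int (3 * N + d) + ternary (\<lambda>j. a (Suc n + j))"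
      by (simp add: d)
    then show ?case by blast
  qed
  then have eq: "digit_wave (3 ^ n * ternary a) = digit_wave (ternary (\<lambda>j. a (n + j)))"
    using digit_wave_periodic by metis
  have "3 * ternary (\<lambda>j. a (n + j)) = 2 * a n + ternary (\<lambda>j. a (Suc n + j))"
    using ternary_shift[of "\<lambda>j. a (n + j)"] a by simp
  moreover have "0 \<le> ternary (\<lambda>j. a (Suc n + j))" "ternary (\<lambda>j. a (Suc n + j)) \<le> 1"
    by (rule ternary_bounds, rule a)+
  ultimately have "digit_wave (ternary (\<lambda>j. a (n + j))) = a n"
    using a[of n] digit_wave_eq_0 digit_wave_eq_1 by auto
  then show ?thesis using eq by simp
qed

text \<open>Continuity of \<open>f\<close> lets almost sure limits pass through it, whereas the
  section \<open>s\<close> only transports laws and need only be measurable. On the open unit ball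
  each \<open>(y \<bullet> b + 1) / 2\<close> lies strictly between 0 and 1, where the binary digits
  sum up to the number.\<close>

lemma space_filling_map:
  obtains f :: "real \<Rightarrow> 'a::euclidean_space" and s :: "'a \<Rightarrow> real"
  where "continuous_on UNIV f" "s \<in> borel_measurable borel"
    "\<And>y. 0 \<le> s y" "\<And>y. s y \<le> 1" "\<And>y. norm y < 1 \<Longrightarrow> f (s y) = y"
proof -
  define code where "code b k = prod_encode (to_nat_on (Basis :: 'a set) b, k)" for b :: 'a and k
  define f :: "real \<Rightarrow> 'a"
    where "f t = (\<Sum>b\<in>Basis. (2 * (\<Sum>k. digit_wave (3 ^ code b k * t) / 2 ^ Suc k) - 1) *\<^sub>R b)" for t
  \<comment> \<open>The index \<open>j\<close> is decoded into a coordinate and a digit position.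
    Indices that belong to no basis vector still receive a digit 0 or 1, which \<open>f\<close>
    never reads.\<close>
  define dig where "dig y j = binary_digit (snd (prod_decode j))
      ((y \<bullet> from_nat_into Basis (fst (prod_decode j)) + 1) / 2)" for y :: 'a and j
  define s where "s y = ternary (dig y)" for y
  have dig: "dig y j = 0 \<or> dig y j = 1" for y j
    unfolding dig_def by (rule binary_digit_cases)
  have cont: "continuous_on UNIV f"
  proof -
    have "continuous_on UNIV (\<lambda>t. \<Sum>k. digit_wave (3 ^ code b k * t) / 2 ^ Suc k)" for b
    proof (rule uniform_limit_theorem)
      show "\<forall>\<^sub>F n in sequentially. continuous_on UNIV (\<lambda>t. \<Sum>k<n. digit_wave (3 ^ code b k * t) / 2 ^ Suc k)"
        unfolding digit_wave_def by (intro always_eventually allI continuous_intros) auto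
      show "uniform_limit UNIV (\<lambda>n t. \<Sum>k<n. digit_wave (3 ^ code b k * t) / 2 ^ Suc k)
          (\<lambda>t. \<Sum>k. digit_wave (3 ^ code b k * t) / 2 ^ Suc k) sequentially"
      proof (rule Weierstrass_m_test)
        show "norm (digit_wave (3 ^ code b k * t) / 2 ^ Suc k) \<le> (1 / 2) ^ k" for k t
          using digit_wave_bounds[of "3 ^ code b k * t"] by (simp add: power_divide divide_simps)
        show "summable (\<lambda>k. (1 / 2 :: real) ^ k)" by (rule summable_geometric) simp
      qed
    qed simp
    then show ?thesis unfolding f_def by (intro continuous_intros)
  qed
  have meas: "s \<in> borel_measurable borel"
    unfolding s_def ternary_def dig_def by measurable
  have inv: "f (s y) = y" if "norm y < 1" for y
  proof -
    have "2 * (\<Sum>k. digit_wave (3 ^ code b k * s y) / 2 ^ Suc k) - 1 = y \<bullet> b" if b: "b \<in> Basis" for b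
    proof -
      have "\<bar>y \<bullet> b\<bar> < 1" using Basis_le_norm[OF b, of y] \<open>norm y < 1\<close> by simp
      then have "(\<lambda>k. binary_digit k ((y \<bullet> b + 1) / 2) / 2 ^ Suc k) sums ((y \<bullet> b + 1) / 2)"
        by (intro binary_digit_sums) auto
      moreover have "digit_wave (3 ^ code b k * s y) = binary_digit k ((y \<bullet> b + 1) / 2)" for k
      proof -
        have "digit_wave (3 ^ code b k * s y) = dig y (code b k)"
          unfolding s_def by (rule digit_wave_ternary) (rule dig)
        also have "\<dots> = binary_digit k ((y \<bullet> b + 1) / 2)"
          unfolding dig_def code_def using b by (simp add: countable_finite)
        finally show ?thesis .
      qed
      ultimately have "(\<Sum>k. digit_wave (3 ^ code b k * s y) / 2 ^ Suc k) = (y \<bullet> b + 1) / 2"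
        by (simp add: sums_unique[symmetric])
      then show ?thesis by (simp del: power_Suc)
    qed
    then have "f (s y) = (\<Sum>b\<in>Basis. (y \<bullet> b) *\<^sub>R b)"
      unfolding f_def by (intro sum.cong) (simp_all del: power_Suc)
    then show ?thesis by (simp add: euclidean_representation)
  qed
  show thesis
    by (rule that[OF cont meas _ _ inv]) (simp_all add: s_def ternary_bounds dig)
qed

section \<open>Weak convergence\<close>

lemma nn_integral_norm_sq_le_limit:
  fixes X :: "nat \<Rightarrow> 'w \<Rightarrow> 'b::euclidean_space"
  assumes [measurable]: "\<And>n. X n \<in> borel_measurable M" "Y \<in> borel_measurable M"
    and lim: "AE \<omega> in M. (\<lambda>n. X n \<omega>) \<longlonglongrightarrow> Y \<omega>"
    and le: "\<And>n. (\<integral>\<^sup>+ \<omega>. ennreal ((norm (X n \<omega>))\<^sup>2) \<partial>M) \<le> c n" and c: "c \<longlonglongrightarrow> C"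
  shows "(\<integral>\<^sup>+ \<omega>. ennreal ((norm (Y \<omega>))\<^sup>2) \<partial>M) \<le> C"
proof -
  have "(\<integral>\<^sup>+ \<omega>. ennreal ((norm (Y \<omega>))\<^sup>2) \<partial>M) = (\<integral>\<^sup>+ \<omega>. liminf (\<lambda>n. ennreal ((norm (X n \<omega>))\<^sup>2)) \<partial>M)"
  proof (rule nn_integral_cong_AE, use lim in eventually_elim)
    case (elim \<omega>)
    then have "(\<lambda>n. ennreal ((norm (X n \<omega>))\<^sup>2)) \<longlonglongrightarrow> ennreal ((norm (Y \<omega>))\<^sup>2)"
      by (intro tendsto_ennrealI tendsto_intros)
    then show ?case using lim_imp_Liminf[OF sequentially_bot] by metis
  qed
  also have "\<dots> \<le> liminf (\<lambda>n. \<integral>\<^sup>+ \<omega>. ennreal ((norm (X n \<omega>))\<^sup>2) \<partial>M)"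
    by (rule nn_integral_liminf) simp
  also have "\<dots> \<le> liminf c" by (intro Liminf_mono always_eventually allI le)
  also have "\<dots> = C" using c by (simp add: lim_imp_Liminf)
  finally show ?thesis .
qed

text \<open>
  The space is mapped by \<open>x \<mapsto> x / (1 + norm x)\<close> onto the open unit ball and from there, by the section
  of the space-filling map, into \<open>[0, 1]\<close>. The moment bound keeps the limit off the boundary of the ball.
\<close>

lemma skorohod_representation_subsequence:
  fixes \<rho> :: "nat \<Rightarrow> 'a::euclidean_space measure"
  assumes prob: "\<And>n. prob_space (\<rho> n)" and sets: "\<And>n. sets (\<rho> n) = sets borel"
    and bound: "\<And>n. (\<integral>\<^sup>+ x. ennreal ((norm x)\<^sup>2) \<partial>\<rho> n) \<le> ennreal C"
  obtains r :: "nat \<Rightarrow> nat" and \<Omega> :: "real measure" and X Y where "strict_mono r" "prob_space \<Omega>"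
    "\<And>n. X n \<in> borel_measurable \<Omega>" "\<And>n. distr \<Omega> borel (X n) = \<rho> (r n)"
    "Y \<in> borel_measurable \<Omega>" "AE \<omega> in \<Omega>. (\<lambda>n. X n \<omega>) \<longlonglongrightarrow> Y \<omega>"
proof -
  note [measurable_cong] = sets
  obtain f :: "real \<Rightarrow> 'a" and s :: "'a \<Rightarrow> real" where f: "continuous_on UNIV f"
    and s[measurable]: "s \<in> borel_measurable borel" and s01: "\<And>y. 0 \<le> s y" "\<And>y. s y \<le> 1"
    and fs: "\<And>y. norm y < 1 \<Longrightarrow> f (s y) = y"
    by (rule space_filling_map) blast
  have [measurable]: "f \<in> borel_measurable borel" using f by (rule borel_measurable_continuous_onI)
  define g where "g x = (1 / (1 + norm x)) *\<^sub>R x" for x :: 'a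
  define h where "h u = (1 / (1 - norm u)) *\<^sub>R u" for u :: 'a
  have [measurable]: "g \<in> borel_measurable borel" "h \<in> borel_measurable borel"
    unfolding g_def h_def by measurable
  have pos: "1 + norm x > 0" for x :: 'a by (rule add_pos_nonneg) auto
  have normg: "norm (g x) = norm x / (1 + norm x)" for x using pos[of x] by (simp add: g_def)
  have g1: "norm (g x) < 1" for x using pos[of x] by (simp add: normg)
  have hg: "h (g x) = x" for x
  proof -
    have "1 - norm (g x) = 1 / (1 + norm x)" using pos[of x] by (simp add: normg field_simps)
    then show ?thesis using pos[of x] unfolding h_def by (simp add: g_def)
  qed
  define \<eta> where "\<eta> n = distr (\<rho> n) borel (\<lambda>x. s (g x))" for n
  have \<eta>: "real_distribution (\<eta> n)" for n
    unfolding \<eta>_def by (intro prob_space.real_distribution_distr prob) measurable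
  \<comment> \<open>All \<open>\<eta> n\<close> live on \<open>[0, 1]\<close>, so one interval
    serves for every \<open>e\<close>; it is open on the left, hence the endpoint -1.\<close>
  have "tight \<eta>" unfolding tight_def
  proof (intro conjI allI impI \<eta>)
    fix e :: real assume "e > 0"
    have "measure (\<eta> n) {-1<..1} > 1 - e" for n
    proof -
      interpret prob_space "\<rho> n" by (rule prob)
      have "(\<lambda>x. s (g x)) -` {-1<..1} \<inter> space (\<rho> n) = space (\<rho> n)"
        using s01(2) less_le_trans[OF _ s01(1), of "-1"] by auto
      then have "measure (\<eta> n) {-1<..1} = 1"
        unfolding \<eta>_def by (subst measure_distr) (auto simp: prob_space)
      then show ?thesis using \<open>e > 0\<close> by simp
    qed
    then show "\<exists>a b. a < b \<and> (\<forall>n. measure (\<eta> n) {a<..b} > 1 - e)"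
      by (intro exI[of _ "-1"] exI[of _ 1]) auto
  qed
  from tight_imp_convergent_subsubsequence[OF this strict_mono_id]
  obtain r M where r: "strict_mono r" and M: "real_distribution M"
    and w: "weak_conv_m (\<eta> \<circ> id \<circ> r) M" by blast
  obtain \<Omega> :: "real measure" and T :: "nat \<Rightarrow> real \<Rightarrow> real" and S where \<Omega>: "prob_space \<Omega>"
    and T[measurable]: "\<And>n. T n \<in> borel_measurable \<Omega>" and dT: "\<And>n. distr \<Omega> borel (T n) = \<eta> (r n)"
    and S: "S \<in> measurable \<Omega> lborel" and lim: "\<And>x. x \<in> space \<Omega> \<Longrightarrow> (\<lambda>n. T n x) \<longlonglongrightarrow> S x"
    using Skorohod[OF _ M w, unfolded comp_def id_apply, OF \<eta>] by blast
  have [measurable]: "S \<in> borel_measurable \<Omega>" using S by simp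
  define X where "X n \<omega> = h (f (T n \<omega>))" for n \<omega>
  define Y where "Y \<omega> = h (f (S \<omega>))" for \<omega>
  have [measurable]: "X n \<in> borel_measurable \<Omega>" "Y \<in> borel_measurable \<Omega>" for n
    unfolding X_def Y_def by measurable
  have dX: "distr \<Omega> borel (X n) = \<rho> (r n)" for n
  proof -
    have "distr \<Omega> borel (X n) = distr (\<eta> (r n)) borel (\<lambda>t. h (f t))"
      unfolding dT[symmetric] by (subst distr_distr) (auto simp: X_def[abs_def] comp_def)
    also have "\<dots> = distr (\<rho> (r n)) borel (\<lambda>x. h (f (s (g x))))"
      unfolding \<eta>_def by (subst distr_distr) (auto simp: comp_def)
    also have "\<dots> = distr (\<rho> (r n)) borel (\<lambda>x. x)" by (simp add: fs g1 hg)
    also have "\<dots> = \<rho> (r n)" by (rule distr_id2) (simp add: sets)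
    finally show ?thesis .
  qed
  \<comment> \<open>\<open>f\<close> inverts \<open>s\<close> on the range of \<open>g\<close>, so
    \<open>f (T n \<omega>)\<close> lies in the open ball almost surely, for all \<open>n\<close> at
    once.\<close>
  have Z1: "AE \<omega> in \<Omega>. \<forall>n. norm (f (T n \<omega>)) < 1"
  proof (subst AE_all_countable, rule allI)
    fix n
    have "AE t in \<eta> (r n). norm (f t) < 1"
      unfolding \<eta>_def by (subst AE_distr_iff) (auto simp: fs g1)
    then show "AE \<omega> in \<Omega>. norm (f (T n \<omega>)) < 1"
      unfolding dT[symmetric] by (subst (asm) AE_distr_iff) auto
  qed
  \<comment> \<open>By Fatou's lemma the moment bound makes the lower limit of
    \<open>(norm (X n \<omega>))\<^sup>2\<close> finite almost surely. This excludes the boundary of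
    the ball, where \<open>h\<close> fails to be continuous.\<close>
  have "(\<integral>\<^sup>+ \<omega>. liminf (\<lambda>n. ennreal ((norm (X n \<omega>))\<^sup>2)) \<partial>\<Omega>)
      \<le> liminf (\<lambda>n. \<integral>\<^sup>+ \<omega>. ennreal ((norm (X n \<omega>))\<^sup>2) \<partial>\<Omega>)"
    by (rule nn_integral_liminf) simp
  also have "\<dots> \<le> ennreal C"
  proof (intro Liminf_le always_eventually allI)
    fix n
    show "(\<integral>\<^sup>+ \<omega>. ennreal ((norm (X n \<omega>))\<^sup>2) \<partial>\<Omega>) \<le> ennreal C"
      using bound[of "r n"] nn_integral_distr[of "X n" \<Omega> borel "\<lambda>x. ennreal ((norm x)\<^sup>2)"] by (simp add: dX)
  qed simp
  also have "\<dots> < \<infinity>" by simp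
  finally have "AE \<omega> in \<Omega>. liminf (\<lambda>n. ennreal ((norm (X n \<omega>))\<^sup>2)) \<noteq> \<infinity>"
    by (intro nn_integral_PInf_AE) auto
  then have "AE \<omega> in \<Omega>. (\<lambda>n. X n \<omega>) \<longlonglongrightarrow> Y \<omega>"
    using Z1 AE_space
  proof eventually_elim
    case (elim \<omega>)
    have Z: "(\<lambda>n. f (T n \<omega>)) \<longlonglongrightarrow> f (S \<omega>)"
      using lim[OF elim(3)] f by (intro isCont_tendsto_compose[of _ f]) (auto simp: continuous_on_eq_continuous_at)
    have nX: "norm (X n \<omega>) = norm (f (T n \<omega>)) / (1 - norm (f (T n \<omega>)))" for n
      using elim(2) by (auto simp: X_def h_def less_imp_le)
    have "norm (f (S \<omega>)) < 1"
    proof (rule ccontr)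
      assume "\<not> norm (f (S \<omega>)) < 1"
      obtain l where l: "0 \<le> l" "liminf (\<lambda>n. ennreal ((norm (X n \<omega>))\<^sup>2)) = ennreal l"
        using elim(1) by (cases "liminf (\<lambda>n. ennreal ((norm (X n \<omega>))\<^sup>2))" rule: ennreal_cases) auto
      \<comment> \<open>\<open>(l + 1) / (l + 2)\<close> is the radius that
        \<open>t / (1 - t)\<close> maps to \<open>l + 1\<close>. If the limit had norm at least 1,
        the norms of \<open>X n \<omega>\<close> would eventually reach \<open>l + 1\<close>,
        although their squares have lower limit \<open>l\<close>.\<close>
      have "(l + 1) / (l + 2) < 1" using l by simp
      then have "(l + 1) / (l + 2) < norm (f (S \<omega>))" using \<open>\<not> norm (f (S \<omega>)) < 1\<close> by linarith
      then have "\<forall>\<^sub>F n in sequentially. (l + 1) / (l + 2) < norm (f (T n \<omega>))"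
        by (intro order_tendstoD(1)[OF tendsto_norm[OF Z]])
      then have "\<forall>\<^sub>F n in sequentially. ennreal ((l + 1)\<^sup>2) \<le> ennreal ((norm (X n \<omega>))\<^sup>2)"
      proof eventually_elim
        case (elim n)
        moreover have "norm (f (T n \<omega>)) < 1" using \<open>\<forall>n. norm (f (T n \<omega>)) < 1\<close> by blast
        ultimately have "l + 1 \<le> norm (X n \<omega>)" unfolding nX using l by (simp add: field_simps)
        then show ?case using l by (intro ennreal_leI power_mono) auto
      qed
      then have "ennreal ((l + 1)\<^sup>2) \<le> ennreal l" unfolding l(2)[symmetric] by (rule Liminf_bounded)
      then have "(l + 1)\<^sup>2 \<le> l" using l by simp
      moreover have "(l + 1)\<^sup>2 = l + (l\<^sup>2 + l + 1)" by (simp add: power2_sum)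
      ultimately show False using l zero_le_power2[of l] by linarith
    qed
    then show ?case unfolding X_def Y_def h_def
      by (intro tendsto_intros Z) auto
  qed
  then show thesis using that[OF r \<Omega>, of X Y] dX by simp
qed

text \<open>By scaling, test functions bounded by 1 represent all bounded continuous ones.\<close>

definition weakly_converges :: "(nat \<Rightarrow> 'a::euclidean_space measure) \<Rightarrow> 'a measure \<Rightarrow> bool" where
  "weakly_converges \<rho> \<sigma> \<longleftrightarrow> (\<forall>h :: 'a \<Rightarrow> real. continuous_on UNIV h \<and> (\<forall>x. \<bar>h x\<bar> \<le> 1)
      \<longrightarrow> (\<lambda>n. \<integral>x. h x \<partial>\<rho> n) \<longlonglongrightarrow> (\<integral>x. h x \<partial>\<sigma>))"

lemma weakly_converges_subseq:
  assumes "weakly_converges \<rho> \<sigma>" "strict_mono r"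
  shows "weakly_converges (\<lambda>n. \<rho> (r n)) \<sigma>"
  using assms LIMSEQ_subseq_LIMSEQ[of _ _ r] unfolding weakly_converges_def comp_def by blast

lemma weakly_converges_AE:
  fixes X :: "nat \<Rightarrow> 'w \<Rightarrow> 'a::euclidean_space"
  assumes \<Omega>: "prob_space \<Omega>" and [measurable]: "\<And>n. X n \<in> borel_measurable \<Omega>" "Y \<in> borel_measurable \<Omega>"
    and lim: "AE \<omega> in \<Omega>. (\<lambda>n. X n \<omega>) \<longlonglongrightarrow> Y \<omega>"
  shows "weakly_converges (\<lambda>n. distr \<Omega> borel (X n)) (distr \<Omega> borel Y)"
  unfolding weakly_converges_def
proof (intro allI impI)
  interpret prob_space \<Omega> by fact
  fix h :: "'a \<Rightarrow> real" assume "continuous_on UNIV h \<and> (\<forall>x. \<bar>h x\<bar> \<le> 1)"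
  then have h: "continuous_on UNIV h" "\<And>x. \<bar>h x\<bar> \<le> 1" by auto
  have [measurable]: "h \<in> borel_measurable borel" using h(1) by (rule borel_measurable_continuous_onI)
  have "(\<lambda>n. \<integral>\<omega>. h (X n \<omega>) \<partial>\<Omega>) \<longlonglongrightarrow> (\<integral>\<omega>. h (Y \<omega>) \<partial>\<Omega>)"
  proof (rule integral_dominated_convergence[where w="\<lambda>_. 1"])
    show "AE \<omega> in \<Omega>. (\<lambda>n. h (X n \<omega>)) \<longlonglongrightarrow> h (Y \<omega>)"
      using lim
    proof eventually_elim
      case (elim \<omega>)
      then show ?case using h(1)
        by (intro isCont_tendsto_compose[of _ h]) (auto simp: continuous_on_eq_continuous_at)
    qed
  qed (auto simp: h(2))
  then show "(\<lambda>n. \<integral>x. h x \<partial>distr \<Omega> borel (X n)) \<longlonglongrightarrow> (\<integral>x. h x \<partial>distr \<Omega> borel Y)"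
    by (simp add: integral_distr)
qed

text \<open>Closed sets are stable under intersection and generate the Borel sets, so it is enough
  to recover their masses from integrals of continuous functions.\<close>

lemma weakly_converges_unique:
  fixes \<sigma> \<tau> :: "'a::euclidean_space measure"
  assumes w: "weakly_converges \<rho> \<sigma>" "weakly_converges \<rho> \<tau>"
    and \<sigma>: "prob_space \<sigma>" "sets \<sigma> = sets borel" and \<tau>: "prob_space \<tau>" "sets \<tau> = sets borel"
  shows "\<sigma> = \<tau>"
proof -
  have int: "(\<integral>x. h x \<partial>\<sigma>) = (\<integral>x. h x \<partial>\<tau>)" if "continuous_on UNIV h" "\<And>x. \<bar>h x\<bar> \<le> 1" for h :: "'a \<Rightarrow> real"
    using LIMSEQ_unique w that unfolding weakly_converges_def by blast
  \<comment> \<open>These functions decrease to the indicator of \<open>C\<close> as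
    \<open>k\<close> grows. The empty set is excluded because \<open>infdist x {}\<close> is 0,
    which would make them constantly 1.\<close>
  have closed_lim: "(\<lambda>k. \<integral>x. max 0 (1 - real k * infdist x C) \<partial>\<mu>) \<longlonglongrightarrow> measure \<mu> C"
    if C: "closed C" "C \<noteq> {}" and \<mu>: "prob_space \<mu>" "sets \<mu> = sets borel" for C :: "'a set" and \<mu>
  proof -
    interpret prob_space \<mu> by fact
    note [measurable_cong] = \<mu>(2)
    have [measurable]: "C \<in> sets borel" using C by simp
    have [measurable]: "(\<lambda>x. infdist x C) \<in> borel_measurable borel"
      by (intro borel_measurable_continuous_onI continuous_intros)
    have "(\<lambda>k. \<integral>x. max 0 (1 - real k * infdist x C) \<partial>\<mu>) \<longlonglongrightarrow> (\<integral>x. indicator C x \<partial>\<mu>)"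
    proof (rule integral_dominated_convergence[where w="\<lambda>_. 1"])
      show "AE x in \<mu>. (\<lambda>k. max 0 (1 - real k * infdist x C)) \<longlonglongrightarrow> indicator C x"
      proof (rule AE_I2)
        fix x
        show "(\<lambda>k. max 0 (1 - real k * infdist x C)) \<longlonglongrightarrow> indicator C x"
        proof (cases "x \<in> C")
          case True
          then have "infdist x C = 0" by simp
          then show ?thesis using True by simp
        next
          case False
          then have pos: "infdist x C > 0" using C
            by (metis in_closed_iff_infdist_zero infdist_nonneg less_eq_real_def)
          have "\<forall>\<^sub>F k in sequentially. max 0 (1 - real k * infdist x C) = 0"
          proof -
            obtain K :: nat where K: "1 / infdist x C < real K" using reals_Archimedean2 by blast
            show ?thesis
            proof (rule eventually_sequentiallyI[of K])
              fix k assume "K \<le> k"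
              then have "1 / infdist x C < real k" using K by linarith
              then have "1 < real k * infdist x C" using pos by (simp add: field_simps)
              then show "max 0 (1 - real k * infdist x C) = 0" by simp
            qed
          qed
          then show ?thesis using False by (simp add: tendsto_eventually)
        qed
      qed
    qed (auto simp: infdist_nonneg)
    then show ?thesis using \<mu>(2) by (simp add: sets_eq_imp_space_eq)
  qed
  have closed: "emeasure \<sigma> C = emeasure \<tau> C" if "closed C" for C
  proof (cases "C = {}")
    case False
    have "(\<integral>x. max 0 (1 - real k * infdist x C) \<partial>\<sigma>) = (\<integral>x. max 0 (1 - real k * infdist x C) \<partial>\<tau>)" for k
      by (rule int) (auto intro!: continuous_intros simp: infdist_nonneg)
    then have "measure \<sigma> C = measure \<tau> C"
      using closed_lim[OF that False \<sigma>] closed_lim[OF that False \<tau>] LIMSEQ_unique by simp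
    then show ?thesis
      using \<sigma>(1) \<tau>(1) by (simp add: finite_measure.emeasure_eq_measure prob_space.finite_measure)
  qed simp
  interpret t: prob_space \<tau> by fact
  show ?thesis
  proof (rule measure_eqI_generator_eq[where \<Omega>=UNIV and E="Collect closed" and A="\<lambda>_. UNIV"])
    show "Int_stable (Collect closed :: 'a set set)" by (auto simp: Int_stable_def)
    show "sets \<sigma> = sigma_sets UNIV (Collect closed)" "sets \<tau> = sigma_sets UNIV (Collect closed)"
      using \<sigma>(2) \<tau>(2) by (simp_all add: borel_eq_closed)
  qed (use closed in auto)
qed

section \<open>Weak limits and the Wasserstein distance\<close>

lemma P2_distr_iff:
  assumes "prob_space \<Omega>" "X \<in> borel_measurable \<Omega>"
  shows "distr \<Omega> borel X \<in> P2 \<longleftrightarrow> (\<integral>\<^sup>+ \<omega>. ennreal ((norm (X \<omega>))\<^sup>2) \<partial>\<Omega>) < \<infinity>"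
  using assms unfolding P2_def by (simp add: nn_integral_distr prob_space.prob_space_distr)

lemma nn_integral_norm_sq_distr:
  assumes "X \<in> borel_measurable \<Omega>" "distr \<Omega> borel X = \<mu>"
  shows "(\<integral>\<^sup>+ \<omega>. ennreal ((norm (X \<omega>))\<^sup>2) \<partial>\<Omega>) = (\<integral>\<^sup>+ x. ennreal ((norm x)\<^sup>2) \<partial>\<mu>)"
  unfolding assms(2)[symmetric] using assms(1) by (simp add: nn_integral_distr)

lemma P2_bounded_imp_weakly_convergent_subseq:
  fixes \<rho> :: "nat \<Rightarrow> 'a::euclidean_space measure"
  assumes \<rho>: "\<And>n. \<rho> n \<in> P2"
    and bound: "\<And>n. (\<integral>\<^sup>+ x. ennreal ((norm x)\<^sup>2) \<partial>\<rho> n) \<le> ennreal C"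
  obtains r :: "nat \<Rightarrow> nat" and \<sigma> where "strict_mono r" "\<sigma> \<in> P2" "weakly_converges (\<lambda>n. \<rho> (r n)) \<sigma>"
proof -
  obtain r and \<Omega> :: "real measure" and X Y where r: "strict_mono r" and \<Omega>: "prob_space \<Omega>"
    and X[measurable]: "\<And>n. X n \<in> borel_measurable \<Omega>" and dX: "\<And>n. distr \<Omega> borel (X n) = \<rho> (r n)"
    and Y[measurable]: "Y \<in> borel_measurable \<Omega>" and lim: "AE \<omega> in \<Omega>. (\<lambda>n. X n \<omega>) \<longlonglongrightarrow> Y \<omega>"
    using skorohod_representation_subsequence[of \<rho> C] P2D[OF \<rho>] bound by blast
  have le: "(\<integral>\<^sup>+ \<omega>. ennreal ((norm (X n \<omega>))\<^sup>2) \<partial>\<Omega>) \<le> ennreal C" for n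
    using bound[of "r n"] nn_integral_distr[of "X n" \<Omega> borel "\<lambda>x. ennreal ((norm x)\<^sup>2)"] by (simp add: dX[symmetric])
  have "(\<integral>\<^sup>+ \<omega>. ennreal ((norm (Y \<omega>))\<^sup>2) \<partial>\<Omega>) \<le> ennreal C"
    by (rule nn_integral_norm_sq_le_limit[OF X Y lim le tendsto_const])
  also have "\<dots> < \<infinity>" by simp
  finally have "distr \<Omega> borel Y \<in> P2" by (simp add: P2_distr_iff \<Omega>)
  moreover have "weakly_converges (\<lambda>n. \<rho> (r n)) (distr \<Omega> borel Y)"
    using weakly_converges_AE[OF \<Omega> X Y lim] by (simp add: dX)
  ultimately show thesis using that r by blast
qed

text \<open>The joint laws, not just the measures \<open>\<rho> n\<close>, are passed to the limit:
  near-optimal couplings have bounded second moments on the product space, so along a subsequence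
  they are realised by almost surely convergent pairs. Uniqueness of weak limits identifies the
  marginals of the limit pair, and Fatou's lemma bounds its cost.\<close>

lemma coupling_limit:
  fixes \<rho> :: "nat \<Rightarrow> 'a::euclidean_space measure"
  assumes \<rho>: "\<And>n. \<rho> n \<in> P2" and \<sigma>: "\<sigma> \<in> P2" and \<nu>: "\<nu> \<in> P2"
    and w: "weakly_converges \<rho> \<sigma>" and L: "(\<lambda>n. W2 (\<rho> n) \<nu>) \<longlonglongrightarrow> L"
  obtains r and \<Omega> :: "real measure" and X Y X' Y' c where "strict_mono r" "prob_space \<Omega>"
    "\<And>n. X n \<in> borel_measurable \<Omega>" "\<And>n. Y n \<in> borel_measurable \<Omega>"
    "\<And>n. distr \<Omega> borel (X n) = \<rho> (r n)" "\<And>n. distr \<Omega> borel (Y n) = \<nu>"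
    "X' \<in> borel_measurable \<Omega>" "Y' \<in> borel_measurable \<Omega>"
    "distr \<Omega> borel X' = \<sigma>" "distr \<Omega> borel Y' = \<nu>"
    "AE \<omega> in \<Omega>. (\<lambda>n. X n \<omega>) \<longlonglongrightarrow> X' \<omega>" "AE \<omega> in \<Omega>. (\<lambda>n. Y n \<omega>) \<longlonglongrightarrow> Y' \<omega>"
    "\<And>n. (\<integral>\<^sup>+ \<omega>. ennreal ((norm (X n \<omega> - Y n \<omega>))\<^sup>2) \<partial>\<Omega>) \<le> ennreal (c n)" "c \<longlonglongrightarrow> L\<^sup>2"
    "(\<integral>\<^sup>+ \<omega>. ennreal ((norm (X' \<omega> - Y' \<omega>))\<^sup>2) \<partial>\<Omega>) \<le> ennreal (L\<^sup>2)"
proof -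
  \<comment> \<open>The slack \<open>1 / real (Suc n)\<close> makes the bound strict, as extracting
    a coupling requires, and vanishes in the limit.\<close>
  define b where "b n = W2 (\<rho> n) \<nu> + 1 / real (Suc n)" for n
  have b0: "0 \<le> b n" for n unfolding b_def by simp
  have b: "b \<longlonglongrightarrow> L"
    using tendsto_add[OF L lim_1_over_n[THEN LIMSEQ_Suc]] unfolding b_def by simp
  have "\<exists>\<pi>. prob_space \<pi> \<and> sets \<pi> = sets (borel \<Otimes>\<^sub>M borel) \<and> distr \<pi> borel fst = \<rho> n \<and>
      distr \<pi> borel snd = \<nu> \<and> (\<integral>\<^sup>+ z. ennreal ((norm (fst z - snd z))\<^sup>2) \<partial>\<pi>) \<le> ennreal ((b n)\<^sup>2)" for n
    by (rule W2_lessE[OF \<rho>[of n] \<nu>, of "b n"]) (auto simp: b_def)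
  then have "\<forall>n. \<exists>\<pi>. prob_space \<pi> \<and> sets \<pi> = sets (borel \<Otimes>\<^sub>M borel) \<and> distr \<pi> borel fst = \<rho> n \<and>
      distr \<pi> borel snd = \<nu> \<and> (\<integral>\<^sup>+ z. ennreal ((norm (fst z - snd z))\<^sup>2) \<partial>\<pi>) \<le> ennreal ((b n)\<^sup>2)"
    by blast
  from choice[OF this]
  obtain \<pi> where \<pi>: "\<And>n. prob_space (\<pi> n)" "\<And>n. sets (\<pi> n) = sets (borel \<Otimes>\<^sub>M borel)"
    "\<And>n. distr (\<pi> n) borel fst = \<rho> n" "\<And>n. distr (\<pi> n) borel snd = \<nu>"
    "\<And>n. (\<integral>\<^sup>+ z. ennreal ((norm (fst z - snd z))\<^sup>2) \<partial>\<pi> n) \<le> ennreal ((b n)\<^sup>2)"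
    by blast
  have \<pi>2: "sets (\<pi> n) = sets borel" for n unfolding \<pi>(2) borel_prod ..
  note [measurable_cong] = \<pi>(2)
  have "Bseq b" by (rule convergent_imp_Bseq[OF convergentI[OF b]])
  then obtain B where "\<forall>n. norm (b n) \<le> B" unfolding Bseq_def by blast
  then have B: "b n \<le> B" for n by (simp add: abs_le_iff)
  define Mn where "Mn = (\<integral>\<^sup>+ x. ennreal ((norm x)\<^sup>2) \<partial>\<nu>)"
  have Mn: "Mn < \<infinity>" unfolding Mn_def using P2D(3)[OF \<nu>] .
  \<comment> \<open>The coefficients come from
    \<open>|(x, y)|\<^sup>2 = |x|\<^sup>2 + |y|\<^sup>2\<close> and
    \<open>|x|\<^sup>2 \<le> 2 |x - y|\<^sup>2 + 2 |y|\<^sup>2\<close>.\<close>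
  define C where "C = 2 * ennreal (B\<^sup>2) + 3 * Mn"
  have C: "C = ennreal (enn2real C)" using Mn unfolding C_def by (simp add: ennreal_mult_less_top)
  have bound: "(\<integral>\<^sup>+ z. ennreal ((norm z)\<^sup>2) \<partial>\<pi> n) \<le> ennreal (enn2real C)" for n
  proof -
    have "(\<integral>\<^sup>+ z. ennreal ((norm z)\<^sup>2) \<partial>\<pi> n)
        \<le> (\<integral>\<^sup>+ z. 2 * ennreal ((norm (fst z - snd z))\<^sup>2) + 3 * ennreal ((norm (snd z))\<^sup>2) \<partial>\<pi> n)"
    proof (rule nn_integral_mono)
      fix z :: "'a \<times> 'a"
      have "(norm z)\<^sup>2 = (norm (fst z))\<^sup>2 + (norm (snd z))\<^sup>2"
        by (simp add: norm_prod_def split_beta)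
      also have "\<dots> \<le> 2 * (norm (fst z - snd z))\<^sup>2 + 3 * (norm (snd z))\<^sup>2"
        using norm_diff_sq_le[of "fst z - snd z" "- snd z"] by simp
      finally have "ennreal ((norm z)\<^sup>2) \<le> ennreal (2 * (norm (fst z - snd z))\<^sup>2 + 3 * (norm (snd z))\<^sup>2)"
        by (rule ennreal_leI)
      then show "ennreal ((norm z)\<^sup>2)
          \<le> 2 * ennreal ((norm (fst z - snd z))\<^sup>2) + 3 * ennreal ((norm (snd z))\<^sup>2)"
        by (simp add: ennreal_mult)
    qed
    also have "\<dots> = 2 * (\<integral>\<^sup>+ z. ennreal ((norm (fst z - snd z))\<^sup>2) \<partial>\<pi> n) + 3 * (\<integral>\<^sup>+ z. ennreal ((norm (snd z))\<^sup>2) \<partial>\<pi> n)"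
      by (simp add: nn_integral_add nn_integral_cmult)
    also have "(\<integral>\<^sup>+ z. ennreal ((norm (snd z))\<^sup>2) \<partial>\<pi> n) = Mn"
      using nn_integral_distr[of snd "\<pi> n" borel "\<lambda>x. ennreal ((norm x)\<^sup>2)"] unfolding Mn_def \<pi>(4)[of n, symmetric] by simp
    also have "2 * (\<integral>\<^sup>+ z. ennreal ((norm (fst z - snd z))\<^sup>2) \<partial>\<pi> n) + 3 * Mn \<le> C"
      unfolding C_def
    proof (intro add_right_mono mult_left_mono)
      show "(\<integral>\<^sup>+ z. ennreal ((norm (fst z - snd z))\<^sup>2) \<partial>\<pi> n) \<le> ennreal (B\<^sup>2)"
        by (rule order_trans[OF \<pi>(5)]) (intro ennreal_leI power_mono B b0)
    qed simp
    finally show ?thesis using C by simp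
  qed
  obtain r and \<Omega> :: "real measure" and Z Z' where r: "strict_mono r" and \<Omega>: "prob_space \<Omega>"
    and Z[measurable]: "\<And>n. Z n \<in> borel_measurable \<Omega>" and dZ: "\<And>n. distr \<Omega> borel (Z n) = \<pi> (r n)"
    and Z'[measurable]: "Z' \<in> borel_measurable \<Omega>" and lim: "AE \<omega> in \<Omega>. (\<lambda>n. Z n \<omega>) \<longlonglongrightarrow> Z' \<omega>"
    by (rule skorohod_representation_subsequence[OF \<pi>(1) \<pi>2 bound]) (rule that)
  define X where "X n \<omega> = fst (Z n \<omega>)" for n \<omega>
  define Y where "Y n \<omega> = snd (Z n \<omega>)" for n \<omega>
  define X' where "X' \<omega> = fst (Z' \<omega>)" for \<omega>
  define Y' where "Y' \<omega> = snd (Z' \<omega>)" for \<omega>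
  have [measurable]: "fst \<in> borel_measurable (borel :: ('a \<times> 'a) measure)"
    "snd \<in> borel_measurable (borel :: ('a \<times> 'a) measure)"
    by (intro borel_measurable_continuous_onI continuous_intros)+
  have m[measurable]: "X n \<in> borel_measurable \<Omega>" "Y n \<in> borel_measurable \<Omega>"
    "X' \<in> borel_measurable \<Omega>" "Y' \<in> borel_measurable \<Omega>" for n
    unfolding X_def Y_def X'_def Y'_def by measurable
  have dX: "distr \<Omega> borel (X n) = \<rho> (r n)" for n
    unfolding \<pi>(3)[symmetric] dZ[symmetric] by (subst distr_distr) (auto simp: X_def[abs_def] comp_def)
  have dY: "distr \<Omega> borel (Y n) = \<nu>" for n
    unfolding \<pi>(4)[of "r n", symmetric] dZ[symmetric] by (subst distr_distr) (auto simp: Y_def[abs_def] comp_def)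
  have limX: "AE \<omega> in \<Omega>. (\<lambda>n. X n \<omega>) \<longlonglongrightarrow> X' \<omega>"
    using lim by eventually_elim (auto simp: X_def X'_def intro: tendsto_fst)
  have limY: "AE \<omega> in \<Omega>. (\<lambda>n. Y n \<omega>) \<longlonglongrightarrow> Y' \<omega>"
    using lim by eventually_elim (auto simp: Y_def Y'_def intro: tendsto_snd)
  have dX': "distr \<Omega> borel X' = \<sigma>"
  proof (rule weakly_converges_unique)
    show "weakly_converges (\<lambda>n. \<rho> (r n)) (distr \<Omega> borel X')"
      using weakly_converges_AE[OF \<Omega> m(1) m(3) limX] by (simp add: dX)
    show "weakly_converges (\<lambda>n. \<rho> (r n)) \<sigma>" by (rule weakly_converges_subseq[OF w r])
  qed (simp_all add: prob_space.prob_space_distr \<Omega> P2D[OF \<sigma>])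
  have dY': "distr \<Omega> borel Y' = \<nu>"
  proof (rule weakly_converges_unique)
    show "weakly_converges (\<lambda>n. \<nu>) (distr \<Omega> borel Y')"
      using weakly_converges_AE[OF \<Omega> m(2) m(4) limY] by (simp add: dY)
    show "weakly_converges (\<lambda>n. \<nu>) \<nu>" by (simp add: weakly_converges_def)
  qed (simp_all add: prob_space.prob_space_distr \<Omega> P2D[OF \<nu>])
  have cost: "(\<integral>\<^sup>+ \<omega>. ennreal ((norm (X n \<omega> - Y n \<omega>))\<^sup>2) \<partial>\<Omega>) \<le> ennreal ((b (r n))\<^sup>2)" for n
    using \<pi>(5)[of "r n"] unfolding dZ[symmetric] by (simp add: nn_integral_distr X_def Y_def)
  have c: "(\<lambda>n. (b (r n))\<^sup>2) \<longlonglongrightarrow> L\<^sup>2"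
    using LIMSEQ_subseq_LIMSEQ[OF b r] by (intro tendsto_intros) (simp add: comp_def)
  have "AE \<omega> in \<Omega>. (\<lambda>n. X n \<omega> - Y n \<omega>) \<longlonglongrightarrow> X' \<omega> - Y' \<omega>"
    using limX limY by eventually_elim (rule tendsto_diff)
  then have "(\<integral>\<^sup>+ \<omega>. ennreal ((norm (X' \<omega> - Y' \<omega>))\<^sup>2) \<partial>\<Omega>) \<le> ennreal (L\<^sup>2)"
    by (rule nn_integral_norm_sq_le_limit[OF _ _ _ cost tendsto_ennrealI[OF c], rotated 2]) simp_all
  then show thesis
    by (rule that[OF r \<Omega> m(1) m(2) dX dY m(3) m(4) dX' dY' limX limY cost c])
qed

text \<open>Along constant sequences a limit of near-optimal couplings is an optimal one. Its cost
  is 0, so the two variables agree almost surely and have the same law.\<close>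

lemma W2_eq_0_imp_eq:
  fixes \<mu> \<nu> :: "'a::euclidean_space measure"
  assumes \<mu>: "\<mu> \<in> P2" and \<nu>: "\<nu> \<in> P2" and 0: "W2 \<mu> \<nu> = 0"
  shows "\<mu> = \<nu>"
proof -
  have "weakly_converges (\<lambda>_. \<mu>) \<mu>" "(\<lambda>n. W2 \<mu> \<nu>) \<longlonglongrightarrow> 0"
    by (simp_all add: weakly_converges_def 0)
  then obtain \<Omega> :: "real measure" and X Y where [measurable]: "X \<in> borel_measurable \<Omega>" "Y \<in> borel_measurable \<Omega>"
    and d: "distr \<Omega> borel X = \<mu>" "distr \<Omega> borel Y = \<nu>"
    and le: "(\<integral>\<^sup>+ \<omega>. ennreal ((norm (X \<omega> - Y \<omega>))\<^sup>2) \<partial>\<Omega>) \<le> ennreal (0\<^sup>2)"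
    by (rule coupling_limit[OF \<mu> \<mu> \<nu>]) blast
  have "AE \<omega> in \<Omega>. ennreal ((norm (X \<omega> - Y \<omega>))\<^sup>2) = 0"
    using le by (subst nn_integral_0_iff_AE[symmetric]) auto
  then have "AE \<omega> in \<Omega>. X \<omega> = Y \<omega>" by eventually_elim simp
  then have "distr \<Omega> borel X = distr \<Omega> borel Y" by (intro distr_cong_AE) auto
  then show ?thesis using d by simp
qed

lemma Metric_space_W2: "Metric_space (P2 :: 'a::euclidean_space measure set) W2"
  by unfold_locales
    (auto simp: W2_commute W2_self_eq_0 intro: W2_eq_0_imp_eq W2_triangle)

lemma W2_le_weak_limit:
  fixes \<rho> :: "nat \<Rightarrow> 'a::euclidean_space measure"
  assumes \<rho>: "\<And>n. \<rho> n \<in> P2" and \<sigma>: "\<sigma> \<in> P2" and \<nu>: "\<nu> \<in> P2"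
    and w: "weakly_converges \<rho> \<sigma>" and L: "(\<lambda>n. W2 (\<rho> n) \<nu>) \<longlonglongrightarrow> L"
  shows "W2 \<sigma> \<nu> \<le> L"
proof -
  have L0: "0 \<le> L" using L by (rule LIMSEQ_le_const) simp
  obtain \<Omega> :: "real measure" and X Y where "prob_space \<Omega>" "X \<in> borel_measurable \<Omega>" "Y \<in> borel_measurable \<Omega>"
    and d: "distr \<Omega> borel X = \<sigma>" "distr \<Omega> borel Y = \<nu>"
    and "(\<integral>\<^sup>+ \<omega>. ennreal ((norm (X \<omega> - Y \<omega>))\<^sup>2) \<partial>\<Omega>) \<le> ennreal (L\<^sup>2)"
    by (rule coupling_limit[OF \<rho> \<sigma> \<nu> w L]) blast
  then have "W2 (distr \<Omega> borel X) (distr \<Omega> borel Y) \<le> L" using L0 by (intro W2_le) auto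
  then show ?thesis using d by simp
qed

lemma W2_convergent_subseq:
  fixes \<rho> :: "nat \<Rightarrow> 'a::euclidean_space measure"
  assumes \<rho>: "\<And>n. \<rho> n \<in> P2" and \<sigma>: "\<sigma> \<in> P2" and \<nu>: "\<nu> \<in> P2"
    and w: "weakly_converges \<rho> \<sigma>" and lim: "(\<lambda>n. W2 (\<rho> n) \<nu>) \<longlonglongrightarrow> W2 \<sigma> \<nu>"
  obtains r :: "nat \<Rightarrow> nat" where "strict_mono r" "(\<lambda>n. W2 (\<rho> (r n)) \<sigma>) \<longlonglongrightarrow> 0"
proof -
  define L where "L = W2 \<sigma> \<nu>"
  obtain r and \<Omega> :: "real measure" and X Y X' Y' c where r: "strict_mono r" and \<Omega>: "prob_space \<Omega>"
    and [measurable]: "\<And>n. X n \<in> borel_measurable \<Omega>" "\<And>n. Y n \<in> borel_measurable \<Omega>"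
    and dX: "\<And>n. distr \<Omega> borel (X n) = \<rho> (r n)" and dY: "\<And>n. distr \<Omega> borel (Y n) = \<nu>"
    and [measurable]: "X' \<in> borel_measurable \<Omega>" "Y' \<in> borel_measurable \<Omega>"
    and dX': "distr \<Omega> borel X' = \<sigma>" and dY': "distr \<Omega> borel Y' = \<nu>"
    and limX: "AE \<omega> in \<Omega>. (\<lambda>n. X n \<omega>) \<longlonglongrightarrow> X' \<omega>" and limY: "AE \<omega> in \<Omega>. (\<lambda>n. Y n \<omega>) \<longlonglongrightarrow> Y' \<omega>"
    and cost: "\<And>n. (\<integral>\<^sup>+ \<omega>. ennreal ((norm (X n \<omega> - Y n \<omega>))\<^sup>2) \<partial>\<Omega>) \<le> ennreal (c n)"
    and c: "c \<longlonglongrightarrow> L\<^sup>2"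
    and cost': "(\<integral>\<^sup>+ \<omega>. ennreal ((norm (X' \<omega> - Y' \<omega>))\<^sup>2) \<partial>\<Omega>) \<le> ennreal (L\<^sup>2)"
    by (rule coupling_limit[OF \<rho> \<sigma> \<nu> w lim[folded L_def]]) blast
  \<comment> \<open>The limit pair is a coupling of \<open>\<sigma>\<close> and
    \<open>\<nu>\<close>, so it costs at least \<open>L\<^sup>2\<close>; together with
    \<open>cost'\<close> it is optimal. Here it matters that the distances tend to
    \<open>W2 \<sigma> \<nu>\<close> itself.\<close>
  have L_le: "L\<^sup>2 \<le> enn2real (\<integral>\<^sup>+ \<omega>. ennreal ((norm (X' \<omega> - Y' \<omega>))\<^sup>2) \<partial>\<Omega>)" (is "_ \<le> enn2real ?D")
  proof -
    have "?D < \<infinity>" using cost' by (rule le_less_trans) simp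
    then have "?D = ennreal ((sqrt (enn2real ?D))\<^sup>2)" by simp
    then have "W2 (distr \<Omega> borel X') (distr \<Omega> borel Y') \<le> sqrt (enn2real ?D)"
      by (intro W2_le \<Omega>) auto
    then have "L \<le> sqrt (enn2real ?D)" by (simp add: dX' dY' L_def)
    then have "L\<^sup>2 \<le> (sqrt (enn2real ?D))\<^sup>2" by (intro power_mono) (auto simp: L_def)
    then show ?thesis by simp
  qed
  define mn where "mn = enn2real (\<integral>\<^sup>+ x. ennreal ((norm x)\<^sup>2) \<partial>\<nu>)"
  define ms where "ms = enn2real (\<integral>\<^sup>+ x. ennreal ((norm x)\<^sup>2) \<partial>\<sigma>)"
  have mn: "(\<integral>\<^sup>+ x. ennreal ((norm x)\<^sup>2) \<partial>\<nu>) = ennreal mn" and ms: "(\<integral>\<^sup>+ x. ennreal ((norm x)\<^sup>2) \<partial>\<sigma>) = ennreal ms"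
    using P2D(3)[OF \<nu>] P2D(3)[OF \<sigma>] unfolding mn_def ms_def by simp_all
  have mom: "(\<integral>\<^sup>+ \<omega>. ennreal ((norm (Y n \<omega>))\<^sup>2) \<partial>\<Omega>) = ennreal mn"
    "(\<integral>\<^sup>+ \<omega>. ennreal ((norm (Y' \<omega>))\<^sup>2) \<partial>\<Omega>) = ennreal mn"
    "(\<integral>\<^sup>+ \<omega>. ennreal ((norm (X' \<omega>))\<^sup>2) \<partial>\<Omega>) = ennreal ms" for n
    unfolding mn[symmetric] ms[symmetric]
    by (simp_all add: nn_integral_norm_sq_distr dY dY' dX')
  have mn0: "0 \<le> mn" and ms0: "0 \<le> ms" unfolding mn_def ms_def by simp_all
  \<comment> \<open>Fatou's lemma is applied to \<open>G\<close>; as \<open>\<integral> F n\<close> tends to \<open>\<integral> G' = K\<close>, this forces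
    \<open>\<integral> (norm (X n - X'))\<^sup>2\<close> to vanish.\<close>
  define F where "F n \<omega> = 3 * (norm (X n \<omega> - Y n \<omega>))\<^sup>2 + 3 * (norm (Y n \<omega>))\<^sup>2 + 3 * (norm (X' \<omega>))\<^sup>2" for n \<omega>
  define G where "G n \<omega> = F n \<omega> - (norm (X n \<omega> - X' \<omega>))\<^sup>2" for n \<omega>
  define G' where "G' \<omega> = 3 * (norm (X' \<omega> - Y' \<omega>))\<^sup>2 + 3 * (norm (Y' \<omega>))\<^sup>2 + 3 * (norm (X' \<omega>))\<^sup>2" for \<omega>
  define K where "K = 3 * L\<^sup>2 + 3 * mn + 3 * ms"
  have [measurable]: "F n \<in> borel_measurable \<Omega>" "G n \<in> borel_measurable \<Omega>" "G' \<in> borel_measurable \<Omega>" for n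
    unfolding F_def G_def G'_def by measurable
  have G0: "0 \<le> G n \<omega>" for n \<omega>
  proof -
    have "norm (X n \<omega> - X' \<omega>) = norm ((X n \<omega> - Y n \<omega>) + Y n \<omega> + - X' \<omega>)" by simp
    also have "\<dots> \<le> norm (X n \<omega> - Y n \<omega>) + norm (Y n \<omega>) + norm (- X' \<omega>)"
      by (meson norm_triangle_ineq add_right_mono order_trans)
    finally have "(norm (X n \<omega> - X' \<omega>))\<^sup>2 \<le> (norm (X n \<omega> - Y n \<omega>) + norm (Y n \<omega>) + norm (X' \<omega>))\<^sup>2"
      by (intro power_mono) auto
    also have "\<dots> \<le> F n \<omega>" unfolding F_def
      using add3_sq_le_weighted[of 1 1 1 "norm (X n \<omega> - Y n \<omega>)" "norm (Y n \<omega>)" "norm (X' \<omega>)"] by simp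
    finally show ?thesis unfolding G_def by simp
  qed
  \<comment> \<open>Nothing is known about the sign of \<open>c n\<close>, hence the absolute value;
    the limit \<open>L\<^sup>2\<close> is nonnegative.\<close>
  have intF: "(\<integral>\<^sup>+ \<omega>. ennreal (F n \<omega>) \<partial>\<Omega>) \<le> ennreal (3 * \<bar>c n\<bar> + 3 * mn + 3 * ms)" for n
  proof -
    have "(\<integral>\<^sup>+ \<omega>. ennreal (F n \<omega>) \<partial>\<Omega>) = 3 * (\<integral>\<^sup>+ \<omega>. ennreal ((norm (X n \<omega> - Y n \<omega>))\<^sup>2) \<partial>\<Omega>) + 3 * ennreal mn + 3 * ennreal ms"
      unfolding F_def by (simp add: ennreal_mult nn_integral_add nn_integral_cmult mom)
    also have "\<dots> \<le> 3 * ennreal \<bar>c n\<bar> + 3 * ennreal mn + 3 * ennreal ms"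
      by (intro add_right_mono mult_left_mono order_trans[OF cost] ennreal_leI) auto
    also have "\<dots> = ennreal (3 * \<bar>c n\<bar> + 3 * mn + 3 * ms)" using mn0 ms0 by (simp add: ennreal_mult)
    finally show ?thesis .
  qed
  have "ennreal K \<le> (\<integral>\<^sup>+ \<omega>. ennreal (G' \<omega>) \<partial>\<Omega>)"
  proof -
    have "(\<integral>\<^sup>+ \<omega>. ennreal (G' \<omega>) \<partial>\<Omega>) = 3 * ?D + 3 * ennreal mn + 3 * ennreal ms"
      unfolding G'_def by (simp add: ennreal_mult nn_integral_add nn_integral_cmult mom)
    moreover have "ennreal (L\<^sup>2) \<le> ?D"
      using ennreal_leI[OF L_le] unfolding ennreal_enn2real[OF le_less_trans[OF cost' ennreal_less_top]] .
    then have "3 * ennreal (L\<^sup>2) + 3 * ennreal mn + 3 * ennreal ms \<le> 3 * ?D + 3 * ennreal mn + 3 * ennreal ms"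
      by (intro add_right_mono mult_left_mono) auto
    ultimately show ?thesis using mn0 ms0 by (simp add: K_def ennreal_mult)
  qed
  also have "\<dots> = (\<integral>\<^sup>+ \<omega>. liminf (\<lambda>n. ennreal (G n \<omega>)) \<partial>\<Omega>)"
  proof (rule nn_integral_cong_AE, use limX limY in eventually_elim)
    case (elim \<omega>)
    have "(\<lambda>n. G n \<omega>) \<longlonglongrightarrow> G' \<omega> - (norm (X' \<omega> - X' \<omega>))\<^sup>2"
      unfolding G_def F_def G'_def by (intro tendsto_intros elim)
    then have "(\<lambda>n. ennreal (G n \<omega>)) \<longlonglongrightarrow> ennreal (G' \<omega>)" by (intro tendsto_ennrealI) simp
    then show ?case using lim_imp_Liminf[OF sequentially_bot] by metis
  qed
  also have "\<dots> \<le> liminf (\<lambda>n. \<integral>\<^sup>+ \<omega>. ennreal (G n \<omega>) \<partial>\<Omega>)" by (rule nn_integral_liminf) simp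
  finally have K_le: "ennreal K \<le> liminf (\<lambda>n. \<integral>\<^sup>+ \<omega>. ennreal (G n \<omega>) \<partial>\<Omega>)" .
  have "(\<lambda>n. W2 (\<rho> (r n)) \<sigma>) \<longlonglongrightarrow> 0"
  proof (rule LIMSEQ_I)
    fix e :: real assume "0 < e"
    \<comment> \<open>The estimate below gives \<open>?A \<le> 2 * d = e\<^sup>2 / 2\<close>, so
      that the square root stays strictly below \<open>e\<close>.\<close>
    define d where "d = e\<^sup>2 / 4"
    have d: "0 < d" using \<open>0 < e\<close> by (simp add: d_def)
    have ev1: "\<forall>\<^sub>F n in sequentially. ennreal (K - d) \<le> (\<integral>\<^sup>+ \<omega>. ennreal (G n \<omega>) \<partial>\<Omega>)"
    proof (cases "K - d \<le> 0")
      case True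
      then show ?thesis by (simp add: ennreal_neg)
    next
      case False
      then have "ennreal (K - d) < ennreal K" using d by (intro ennreal_lessI) auto
      then have "ennreal (K - d) < liminf (\<lambda>n. \<integral>\<^sup>+ \<omega>. ennreal (G n \<omega>) \<partial>\<Omega>)" using K_le by (rule less_le_trans)
      from less_LiminfD[OF this] show ?thesis by eventually_elim (rule less_imp_le)
    qed
    have "(\<lambda>n. 3 * \<bar>c n\<bar> + 3 * mn + 3 * ms) \<longlonglongrightarrow> 3 * \<bar>L\<^sup>2\<bar> + 3 * mn + 3 * ms"
      by (intro tendsto_intros c)
    then have "(\<lambda>n. 3 * \<bar>c n\<bar> + 3 * mn + 3 * ms) \<longlonglongrightarrow> K" unfolding K_def by simp
    then have ev2: "\<forall>\<^sub>F n in sequentially. 3 * \<bar>c n\<bar> + 3 * mn + 3 * ms < K + d"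
      by (rule order_tendstoD(2)) (use d in simp)
    have "\<forall>\<^sub>F n in sequentially. W2 (\<rho> (r n)) \<sigma> < e"
      using ev1 ev2
    proof eventually_elim
      case (elim n)
      let ?A = "\<integral>\<^sup>+ \<omega>. ennreal ((norm (X n \<omega> - X' \<omega>))\<^sup>2) \<partial>\<Omega>"
      have "?A + (\<integral>\<^sup>+ \<omega>. ennreal (G n \<omega>) \<partial>\<Omega>) = (\<integral>\<^sup>+ \<omega>. ennreal (F n \<omega>) \<partial>\<Omega>)"
        by (subst nn_integral_add[symmetric]) (auto simp: ennreal_plus[symmetric] G0 G_def[symmetric] simp del: ennreal_plus, simp add: G_def)
      moreover have "?A + ennreal (K - d) \<le> ?A + (\<integral>\<^sup>+ \<omega>. ennreal (G n \<omega>) \<partial>\<Omega>)"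
        by (intro add_left_mono elim)
      moreover have "ennreal (3 * \<bar>c n\<bar> + 3 * mn + 3 * ms) \<le> ennreal (K + d)"
        by (intro ennreal_leI less_imp_le elim)
      ultimately have A_le: "?A + ennreal (K - d) \<le> ennreal (K + d)"
        using intF[of n] by order
      \<comment> \<open>\<open>ennreal\<close> truncates a negative \<open>K - d\<close> to 0, so
        there is nothing to cancel; but then \<open>K < d\<close>, and \<open>K + d\<close> is
        already below \<open>2 * d\<close>.\<close>
      have "?A \<le> ennreal (2 * d)"
      proof (cases "0 \<le> K - d")
        case True
        then have "ennreal (K + d) = ennreal (2 * d) + ennreal (K - d)"
          using d by (simp add: ennreal_plus[symmetric] del: ennreal_plus)
        then show ?thesis using A_le
          by (simp add: add.commute[of _ "ennreal (K - d)"] ennreal_add_left_cancel_le)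
      next
        case False
        then have "?A \<le> ennreal (K + d)" using A_le by (simp add: ennreal_neg)
        also have "\<dots> \<le> ennreal (2 * d)" using False by (intro ennreal_leI) simp
        finally show ?thesis .
      qed
      then have "?A \<le> ennreal ((sqrt (2 * d))\<^sup>2)" using d by simp
      then have "W2 (distr \<Omega> borel (X n)) (distr \<Omega> borel X') \<le> sqrt (2 * d)"
        using d by (intro W2_le \<Omega>) auto
      also have "\<dots> < sqrt (e\<^sup>2)" using \<open>0 < e\<close> by (intro real_sqrt_less_mono) (simp add: d_def)
      finally show ?case using \<open>0 < e\<close> by (simp add: dX dX')
    qed
    then show "\<exists>N. \<forall>n\<ge>N. norm (W2 (\<rho> (r n)) \<sigma> - 0) < e"
      by (simp add: eventually_sequentially)
  qed
  then show thesis using that r by blast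
qed

section \<open>Barycenters\<close>

text \<open>Successive extraction, one index at a time: a further subsequence keeps the limits
  already obtained.\<close>

lemma finite_family_convergent_subseq:
  fixes a :: "'i \<Rightarrow> nat \<Rightarrow> real"
  assumes "finite A" "\<And>j. j \<in> A \<Longrightarrow> bounded (range (a j))"
  shows "\<exists>r :: nat \<Rightarrow> nat. strict_mono r \<and> (\<forall>j\<in>A. convergent (\<lambda>n. a j (r n)))"
  using assms
proof (induction A)
  case empty
  show ?case using strict_mono_id by blast
next
  case (insert i A)
  then obtain r :: "nat \<Rightarrow> nat" where r: "strict_mono r" "\<forall>j\<in>A. convergent (\<lambda>n. a j (r n))" by auto
  have "bounded (range (\<lambda>n. a i (r n)))"
    by (rule bounded_subset[OF insert.prems[of i]]) auto
  then obtain l q where q: "strict_mono (q :: nat \<Rightarrow> nat)" "((\<lambda>n. a i (r n)) \<circ> q) \<longlonglongrightarrow> l"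
    using bounded_imp_convergent_subsequence[of "\<lambda>n. a i (r n)"] by blast
  have "convergent (\<lambda>n. a j (r (q n)))" if "j \<in> insert i A" for j
  proof (cases "j = i")
    case True
    then show ?thesis using q(2) by (auto simp: comp_def convergent_def)
  next
    case False
    then have "convergent (\<lambda>n. a j (r n))" using that r by auto
    then show ?thesis using convergent_subseq_convergent[OF _ q(1)] by (simp add: comp_def)
  qed
  moreover have "strict_mono (\<lambda>n. r (q n))" using r(1) q(1) by (simp add: strict_mono_def)
  ultimately show ?case by blast
qed

lemma W2_diff_le:
  assumes "\<mu> \<in> P2" "\<nu> \<in> P2" "\<nu>' \<in> P2"
  shows "\<bar>W2 \<mu> \<nu> - W2 \<mu> \<nu>'\<bar> \<le> W2 \<nu> \<nu>'"
  using W2_triangle[OF assms(1,2,3)] W2_triangle[OF assms(1,3,2)] W2_commute[of \<nu> \<nu>'] by linarith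

lemma subseq_ge_1:
  fixes q :: "nat \<Rightarrow> nat"
  assumes "strict_mono q" "1 \<le> n" shows "1 \<le> q n"
  using assms strict_mono_imp_increasing[of q n] by linarith

text \<open>The data are only assumed at positive indices, so the subsequences \<open>q\<close>
  considered below carry \<open>1 \<le> q n\<close>.\<close>

locale barycenter_sequence =
  fixes J :: nat
    and \<mu>n :: "nat \<Rightarrow> nat \<Rightarrow> 'a::euclidean_space measure"
    and \<mu> :: "nat \<Rightarrow> 'a measure"
    and w :: "nat \<Rightarrow> real"
    and \<mu>B :: "nat \<Rightarrow> 'a measure"
  assumes J: "J \<ge> 1"
    and \<mu>n: "\<And>n j. n \<ge> 1 \<Longrightarrow> j \<in> {1..J} \<Longrightarrow> \<mu>n n j \<in> P2"
    and \<mu>: "\<And>j. j \<in> {1..J} \<Longrightarrow> \<mu> j \<in> P2"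
    and lim: "\<And>j. j \<in> {1..J} \<Longrightarrow> (\<lambda>n. W2 (\<mu>n n j) (\<mu> j)) \<longlonglongrightarrow> 0"
    and w: "\<And>j. j \<in> {1..J} \<Longrightarrow> w j > 0"
    and bary: "\<And>n. n \<ge> 1 \<Longrightarrow> is_barycenter J (\<mu>n n) w (\<mu>B n)"
begin

lemma \<mu>B: "n \<ge> 1 \<Longrightarrow> \<mu>B n \<in> P2"
  using bary unfolding is_barycenter_def by blast

text \<open>By the triangle inequality the error is at most
  \<open>W2 (\<mu>n (q n) j) (\<mu> j)\<close>, uniformly in \<open>\<rho> n\<close>. Hence fixed
  competitors and the barycenters themselves are both allowed as first argument.\<close>

lemma tendsto_W2_moving:
  assumes q: "strict_mono q" "\<And>n :: nat. 1 \<le> q n" and j: "j \<in> {1..J}" and \<rho>: "\<And>n. \<rho> n \<in> P2"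
  shows "(\<lambda>n. W2 (\<rho> n) (\<mu>n (q n) j)) \<longlonglongrightarrow> L \<longleftrightarrow> (\<lambda>n. W2 (\<rho> n) (\<mu> j)) \<longlonglongrightarrow> L"
proof -
  have d: "(\<lambda>n. W2 (\<rho> n) (\<mu>n (q n) j) - W2 (\<rho> n) (\<mu> j)) \<longlonglongrightarrow> 0"
  proof (rule Lim_null_comparison)
    show "\<forall>\<^sub>F n in sequentially. norm (W2 (\<rho> n) (\<mu>n (q n) j) - W2 (\<rho> n) (\<mu> j)) \<le> W2 (\<mu>n (q n) j) (\<mu> j)"
      using W2_diff_le[OF \<rho> \<mu>n[OF q(2) j] \<mu>[OF j]] by simp
    show "(\<lambda>n. W2 (\<mu>n (q n) j) (\<mu> j)) \<longlonglongrightarrow> 0"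
      using LIMSEQ_subseq_LIMSEQ[OF lim[OF j] q(1)] by (simp add: comp_def)
  qed
  show ?thesis using tendsto_add[OF d, of "\<lambda>n. W2 (\<rho> n) (\<mu> j)" L]
      tendsto_diff[OF _ d, of "\<lambda>n. W2 (\<rho> n) (\<mu>n (q n) j)" L] by auto
qed

text \<open>Minimality passes to the limit. The \<open>L j\<close> are arbitrary numbers: they are
  the distances of a limit measure once \<open>W2\<close> convergence is known, and mere limits
  along a subsequence where that convergence is still to be established.\<close>

lemma objective_limit_le:
  assumes q: "strict_mono q" "\<And>n :: nat. 1 \<le> q n" and \<rho>: "\<rho> \<in> P2"
    and L: "\<And>j. j \<in> {1..J} \<Longrightarrow> (\<lambda>n. W2 (\<mu>B (q n)) (\<mu> j)) \<longlonglongrightarrow> L j"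
  shows "(\<Sum>j=1..J. w j * (L j)\<^sup>2) \<le> (\<Sum>j=1..J. w j * (W2 \<rho> (\<mu> j))\<^sup>2)"
proof (rule LIMSEQ_le)
  show "(\<lambda>n. \<Sum>j=1..J. w j * (W2 (\<mu>B (q n)) (\<mu>n (q n) j))\<^sup>2) \<longlonglongrightarrow> (\<Sum>j=1..J. w j * (L j)\<^sup>2)"
    using L by (intro tendsto_intros) (subst tendsto_W2_moving[OF q], auto intro: \<mu>B q)
  show "(\<lambda>n. \<Sum>j=1..J. w j * (W2 \<rho> (\<mu>n (q n) j))\<^sup>2) \<longlonglongrightarrow> (\<Sum>j=1..J. w j * (W2 \<rho> (\<mu> j))\<^sup>2)"
    by (intro tendsto_intros) (subst tendsto_W2_moving[OF q], auto intro: \<rho>)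
  show "\<exists>N. \<forall>n\<ge>N. (\<Sum>j=1..J. w j * (W2 (\<mu>B (q n)) (\<mu>n (q n) j))\<^sup>2) \<le> (\<Sum>j=1..J. w j * (W2 \<rho> (\<mu>n (q n) j))\<^sup>2)"
    using bary[OF q(2)] \<rho> unfolding is_barycenter_def by blast
qed

lemma bounded_W2:
  assumes q: "strict_mono q" "\<And>n :: nat. 1 \<le> q n" and j: "j \<in> {1..J}"
  shows "bounded (range (\<lambda>n. W2 (\<mu>B (q n)) (\<mu> j)))"
proof -
  \<comment> \<open>\<open>V\<close> is the objective at the fixed competitor
    \<open>\<mu> j\<close>; it converges and so bounds the optimal values. Since
    \<open>w j > 0\<close>, it bounds the \<open>j\<close>-th distance as well.\<close>
  define V where "V n = (\<Sum>i=1..J. w i * (W2 (\<mu> j) (\<mu>n (q n) i))\<^sup>2)" for n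
  have "V \<longlonglongrightarrow> (\<Sum>i=1..J. w i * (W2 (\<mu> j) (\<mu> i))\<^sup>2)"
    unfolding V_def by (intro tendsto_intros) (subst tendsto_W2_moving[OF q], auto intro: \<mu> j)
  from convergent_imp_Bseq[OF convergentI[OF this]]
  obtain K where K: "\<And>n. norm (V n) \<le> K" unfolding Bseq_def by blast
  have "(\<lambda>n. W2 (\<mu>n (q n) j) (\<mu> j)) \<longlonglongrightarrow> 0"
    using LIMSEQ_subseq_LIMSEQ[OF lim[OF j] q(1)] by (simp add: comp_def)
  from convergent_imp_Bseq[OF convergentI[OF this]]
  obtain D where D: "\<And>n. norm (W2 (\<mu>n (q n) j) (\<mu> j)) \<le> D" unfolding Bseq_def by blast
  have "norm (W2 (\<mu>B (q n)) (\<mu> j)) \<le> sqrt (K / w j) + D" for n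
  proof -
    have "w j * (W2 (\<mu>B (q n)) (\<mu>n (q n) j))\<^sup>2 \<le> (\<Sum>i=1..J. w i * (W2 (\<mu>B (q n)) (\<mu>n (q n) i))\<^sup>2)"
      using j w by (intro member_le_sum) (auto simp: less_imp_le)
    also have "\<dots> \<le> V n" unfolding V_def
      using bary[OF q(2)] \<mu>[OF j] unfolding is_barycenter_def by blast
    also have "\<dots> \<le> K" using K[of n] by simp
    finally have "(W2 (\<mu>B (q n)) (\<mu>n (q n) j))\<^sup>2 \<le> K / w j" using w[OF j] by (simp add: field_simps)
    then have "W2 (\<mu>B (q n)) (\<mu>n (q n) j) \<le> sqrt (K / w j)" by (rule real_le_rsqrt)
    moreover have "W2 (\<mu>B (q n)) (\<mu> j) \<le> W2 (\<mu>B (q n)) (\<mu>n (q n) j) + W2 (\<mu>n (q n) j) (\<mu> j)"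
      by (intro W2_triangle \<mu>B \<mu>n \<mu> q j)
    moreover have "W2 (\<mu>n (q n) j) (\<mu> j) \<le> D" using D[of n] by simp
    ultimately show ?thesis by simp
  qed
  then show ?thesis unfolding bounded_iff by blast
qed

lemma limit_is_barycenter:
  assumes q: "strict_mono q" "\<And>n :: nat. 1 \<le> q n" and \<sigma>: "\<sigma> \<in> P2"
    and conv: "(\<lambda>n. W2 (\<mu>B (q n)) \<sigma>) \<longlonglongrightarrow> 0"
  shows "is_barycenter J \<mu> w \<sigma>"
  unfolding is_barycenter_def
proof (intro conjI ballI \<sigma>)
  fix \<rho> :: "'a measure" assume \<rho>: "\<rho> \<in> P2"
  have "(\<lambda>n. W2 (\<mu>B (q n)) (\<mu> j)) \<longlonglongrightarrow> W2 \<sigma> (\<mu> j)" if j: "j \<in> {1..J}" for j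
  proof (rule LIM_zero_cancel, rule Lim_null_comparison[OF _ conv])
    show "\<forall>\<^sub>F n in sequentially. norm (W2 (\<mu>B (q n)) (\<mu> j) - W2 \<sigma> (\<mu> j)) \<le> W2 (\<mu>B (q n)) \<sigma>"
      using W2_diff_le[OF \<mu>[OF j] \<mu>B[OF q(2)] \<sigma>] by (simp add: W2_commute[of "\<mu> j"])
  qed
  from objective_limit_le[OF q \<rho> this]
  show "(\<Sum>j=1..J. w j * (W2 \<sigma> (\<mu> j))\<^sup>2) \<le> (\<Sum>j=1..J. w j * (W2 \<rho> (\<mu> j))\<^sup>2)" .
qed

lemma convergent_subsequence:
  assumes q: "strict_mono q" "\<And>n :: nat. 1 \<le> q n"
  obtains r :: "nat \<Rightarrow> nat" and \<sigma> where "strict_mono r" "\<sigma> \<in> P2" "(\<lambda>n. W2 (\<mu>B (q (r n))) \<sigma>) \<longlonglongrightarrow> 0"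
proof -
  have 1: "1 \<in> {1..J}" using J by simp
  obtain B where B: "\<And>n. W2 (\<mu>B (q n)) (\<mu> 1) \<le> B"
    using bounded_W2[OF q 1] unfolding bounded_iff by (metis abs_le_D1 rangeI real_norm_def)
  \<comment> \<open>\<open>B + 1\<close> supplies the strict inequality asked for by
    \<open>second_moment_le\<close>.\<close>
  define C where "C = 2 * ennreal ((B + 1)\<^sup>2) + 2 * (\<integral>\<^sup>+ x. ennreal ((norm x)\<^sup>2) \<partial>\<mu> 1)"
  have "C < \<infinity>" unfolding C_def using P2D(3)[OF \<mu>[OF 1]] by (simp add: ennreal_mult_less_top)
  then have C: "C = ennreal (enn2real C)" by simp
  have "(\<integral>\<^sup>+ x. ennreal ((norm x)\<^sup>2) \<partial>\<mu>B (q n)) \<le> ennreal (enn2real C)" for n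
    unfolding C[symmetric] unfolding C_def
    using B[of n] by (intro second_moment_le \<mu>B q \<mu> 1) simp
  then obtain r1 \<sigma> where r1: "strict_mono r1" and \<sigma>: "\<sigma> \<in> P2"
    and wk1: "weakly_converges (\<lambda>n. \<mu>B (q (r1 n))) \<sigma>"
    using P2_bounded_imp_weakly_convergent_subseq[of "\<lambda>n. \<mu>B (q n)" "enn2real C"] \<mu>B q(2) by blast
  have "bounded (range (\<lambda>n. W2 (\<mu>B (q (r1 n))) (\<mu> j)))" if "j \<in> {1..J}" for j
    using bounded_W2[OF q that] by (rule bounded_subset) auto
  then obtain r2 :: "nat \<Rightarrow> nat" where r2: "strict_mono r2"
    and "\<forall>j\<in>{1..J}. convergent (\<lambda>n. W2 (\<mu>B (q (r1 (r2 n)))) (\<mu> j))"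
    using finite_family_convergent_subseq[of "{1..J}" "\<lambda>j n. W2 (\<mu>B (q (r1 n))) (\<mu> j)"] by auto
  then obtain L where L: "\<And>j. j \<in> {1..J} \<Longrightarrow> (\<lambda>n. W2 (\<mu>B (q (r1 (r2 n)))) (\<mu> j)) \<longlonglongrightarrow> L j"
    unfolding convergent_def by metis
  define p where "p n = q (r1 (r2 n))" for n
  have p: "strict_mono p" "\<And>n. 1 \<le> p n"
    using q r1 r2 unfolding p_def strict_mono_def by auto
  have wk: "weakly_converges (\<lambda>n. \<mu>B (p n)) \<sigma>"
    unfolding p_def by (rule weakly_converges_subseq[OF wk1 r2])
  have le: "W2 \<sigma> (\<mu> j) \<le> L j" if j: "j \<in> {1..J}" for j
    using L[OF j] by (intro W2_le_weak_limit[OF _ \<sigma> \<mu>[OF j] wk] \<mu>B p) (simp add: p_def)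
  \<comment> \<open>Lower semicontinuity gives \<open>le\<close> for each \<open>j\<close>, while
    minimality bounds the weighted sum of the \<open>(L j)\<^sup>2\<close> by the value at
    \<open>\<sigma>\<close>. As \<open>w 1 > 0\<close>, a strict gap at index 1 would contradict
    this. Index 1 stands for any index; \<open>J \<ge> 1\<close> provides it.\<close>
  have "L 1 = W2 \<sigma> (\<mu> 1)"
  proof (rule ccontr)
    assume "L 1 \<noteq> W2 \<sigma> (\<mu> 1)"
    then have "W2 \<sigma> (\<mu> 1) < L 1" using le[OF 1] by simp
    then have "(W2 \<sigma> (\<mu> 1))\<^sup>2 < (L 1)\<^sup>2" by (intro power_strict_mono) auto
    then have "(\<Sum>j=1..J. w j * (W2 \<sigma> (\<mu> j))\<^sup>2) < (\<Sum>j=1..J. w j * (L j)\<^sup>2)"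
      using 1 w le by (intro sum_strict_mono_ex1 bexI[of _ 1]) (auto intro!: mult_left_mono power_mono simp: less_imp_le)
    also have "\<dots> \<le> (\<Sum>j=1..J. w j * (W2 \<sigma> (\<mu> j))\<^sup>2)"
      using L by (intro objective_limit_le[OF p \<sigma>]) (simp add: p_def)
    finally show False by simp
  qed
  then have "(\<lambda>n. W2 (\<mu>B (p n)) (\<mu> 1)) \<longlonglongrightarrow> W2 \<sigma> (\<mu> 1)" using L[OF 1] by (simp add: p_def)
  from W2_convergent_subseq[OF \<mu>B[OF p(2)] \<sigma> \<mu>[OF 1] wk this]
  obtain r3 :: "nat \<Rightarrow> nat" where r3: "strict_mono r3" "(\<lambda>n. W2 (\<mu>B (p (r3 n))) \<sigma>) \<longlonglongrightarrow> 0" by blast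
  show thesis
  proof (rule that[OF _ \<sigma>])
    show "strict_mono (\<lambda>n. r1 (r2 (r3 n)))" using r1 r2 r3 unfolding strict_mono_def by blast
    show "(\<lambda>n. W2 (\<mu>B (q (r1 (r2 (r3 n))))) \<sigma>) \<longlonglongrightarrow> 0" using r3 by (simp add: p_def)
  qed
qed

text \<open>In a metric space the closure of a set is compact iff each infinite subset has an
  accumulation point. This concerns the set of values rather than the sequence, so an infinite set
  of values is listed along increasing indices.\<close>

lemma relatively_compact: "relatively_compact_in W2_topology (\<mu>B ` {1..})"
proof -
  interpret Metric_space "P2 :: 'a measure set" W2 by (rule Metric_space_W2)
  have "mtopology derived_set_of T \<noteq> {}" if T: "infinite T" "T \<subseteq> \<mu>B ` {1..}" for T
  proof -
    \<comment> \<open>\<open>I\<close> keeps only the first index of each value in \<open>T\<close>,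
      so its increasing enumeration \<open>q\<close> visits pairwise distinct measures.\<close>
    define I where "I = {n. 1 \<le> n \<and> \<mu>B n \<in> T \<and> (\<forall>m. 1 \<le> m \<and> m < n \<longrightarrow> \<mu>B m \<noteq> \<mu>B n)}"
    have "T \<subseteq> \<mu>B ` I"
    proof
      fix t assume t: "t \<in> T"
      define n where "n = (LEAST n. 1 \<le> n \<and> \<mu>B n = t)"
      have ex: "\<exists>n. 1 \<le> n \<and> \<mu>B n = t" using t T(2) by auto
      have n: "1 \<le> n \<and> \<mu>B n = t" unfolding n_def using LeastI_ex[OF ex] .
      have "\<mu>B m \<noteq> t" if "1 \<le> m" "m < n" for m
        using not_less_Least[of m "\<lambda>n. 1 \<le> n \<and> \<mu>B n = t"] that unfolding n_def by blast
      then show "t \<in> \<mu>B ` I" using n t unfolding I_def by auto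
    qed
    then have infI: "infinite I" using T(1) by (meson finite_imageI finite_subset)
    define q where "q = enumerate I"
    have q: "strict_mono q" unfolding q_def by (rule strict_mono_enumerate[OF infI])
    have qI: "q n \<in> I" for n unfolding q_def by (rule enumerate_in_set[OF infI])
    have q1: "1 \<le> q n" and qT: "\<mu>B (q n) \<in> T" for n using qI[of n] by (auto simp: I_def)
    have inj: "\<mu>B (q m) \<noteq> \<mu>B (q n)" if "m < n" for m n
      using qI[of n] q1[of m] strict_monoD[OF q that] unfolding I_def by blast
    obtain r \<sigma> where r: "strict_mono r" and \<sigma>: "\<sigma> \<in> P2" and conv: "(\<lambda>n. W2 (\<mu>B (q (r n))) \<sigma>) \<longlonglongrightarrow> 0"
      using convergent_subsequence[OF q q1] by blast
    have "\<exists>y\<in>T. y \<noteq> \<sigma> \<and> y \<in> mball \<sigma> e" if "e > 0" for e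
    proof -
      obtain N where N: "\<And>n. n \<ge> N \<Longrightarrow> W2 (\<mu>B (q (r n))) \<sigma> < e"
        using order_tendstoD(2)[OF conv \<open>e > 0\<close>] unfolding eventually_sequentially by blast
      \<comment> \<open>An accumulation point asks for elements of \<open>T\<close> other than
        \<open>\<sigma>\<close>; of two distinct terms at most one equals
        \<open>\<sigma>\<close>.\<close>
      have "\<mu>B (q (r N)) \<noteq> \<mu>B (q (r (Suc N)))" by (intro inj strict_monoD[OF r]) simp
      then obtain n where "n \<ge> N" "\<mu>B (q (r n)) \<noteq> \<sigma>" by (metis le_refl le_SucI)
      then show ?thesis using N[of n] qT \<sigma> \<mu>B[OF q1]
        by (intro bexI[of _ "\<mu>B (q (r n))"]) (auto simp: W2_commute)
    qed
    then show ?thesis using \<sigma> unfolding metric_derived_set_of by blast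
  qed
  then have "compactin mtopology (mtopology closure_of (\<mu>B ` {1..}))"
    unfolding compact_closure_of_eq_Bolzano_Weierstrass by blast
  moreover have "\<mu>B ` {1..} \<subseteq> topspace mtopology" using \<mu>B by auto
  ultimately show ?thesis unfolding relatively_compact_in_def W2_topology_def by blast
qed

lemma limit_point_is_barycenter:
  assumes "sequence_limit_point W2_topology \<mu>B \<sigma>"
  shows "is_barycenter J \<mu> w \<sigma>"
proof -
  interpret Metric_space "P2 :: 'a measure set" W2 by (rule Metric_space_W2)
  obtain r where r: "strict_mono r" and l: "limitin mtopology (\<mu>B \<circ> r) \<sigma> sequentially"
    using assms unfolding sequence_limit_point_def W2_topology_def by (elim exE conjE)
  have \<sigma>: "\<sigma> \<in> P2" and conv: "(\<lambda>n. W2 (\<mu>B (r n)) \<sigma>) \<longlonglongrightarrow> 0"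
    using l unfolding limitin_metric_dist_null by (auto simp: comp_def)
  show ?thesis
  proof (rule limit_is_barycenter[OF _ _ \<sigma>])
    \<comment> \<open>\<open>r 0\<close> may be 0, an index at which nothing is assumed about
      \<open>\<mu>B\<close>; the shift drops it without changing the limit.\<close>
    show "strict_mono (\<lambda>n. r (Suc n))" using r by (simp add: strict_mono_def)
    show "1 \<le> r (Suc n)" for n by (rule subseq_ge_1[OF r]) simp
    show "(\<lambda>n. W2 (\<mu>B (r (Suc n))) \<sigma>) \<longlonglongrightarrow> 0" using conv by (rule LIMSEQ_Suc)
  qed
qed

end

theorem theorem3p1:
  fixes J :: nat
    and \<mu>n :: "nat \<Rightarrow> nat \<Rightarrow> (real ^ 'd) measure"
    and \<mu> :: "nat \<Rightarrow> (real ^ 'd) measure"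
    and w :: "nat \<Rightarrow> real"
    and \<mu>B :: "nat \<Rightarrow> (real ^ 'd) measure"
  assumes "J \<ge> 1"
    and "\<And>n j. n \<ge> 1 \<Longrightarrow> j \<in> {1..J} \<Longrightarrow> \<mu>n n j \<in> P2"
    and "\<And>j. j \<in> {1..J} \<Longrightarrow> \<mu> j \<in> P2"
    and "\<And>j. j \<in> {1..J} \<Longrightarrow> (\<lambda>n. W2 (\<mu>n n j) (\<mu> j)) \<longlonglongrightarrow> 0"
    and "\<And>j. j \<in> {1..J} \<Longrightarrow> w j > 0"
    and "(\<Sum>j=1..J. w j) = 1"
    and "\<And>n. n \<ge> 1 \<Longrightarrow> is_barycenter J (\<mu>n n) w (\<mu>B n)"
  shows "relatively_compact_in W2_topology (\<mu>B ` {1..})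
    \<and> (\<forall>\<mu>'. sequence_limit_point W2_topology \<mu>B \<mu>' \<longrightarrow> is_barycenter J \<mu> w \<mu>')"
proof -
  interpret barycenter_sequence J \<mu>n \<mu> w \<mu>B
    by (rule barycenter_sequence.intro) (fact assms)+
  show ?thesis using relatively_compact limit_point_is_barycenter by blast
qed

end
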